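(* (Compactness) In the Ctrie algorithm described in the context, assume all remove operations have completed execution. Then there is at most one tip of length 1 in the trie.
   Context: Setting. A Ctrie is a concurrent shared-memory map from keys to values, accessed by several threads using atomic reads and single-word compare-and-swap, written CAS$(x,e,n)$: atomically, if location $x$ holds $e$ then write $n$ and succeed, otherwise fail. Keys have hashcodes (bit strings). Fix the branching width $W\ge1$. The hashcode chunk of key $k$ at level $l$ (levels are multiples of $W$) is $m(l,k)=(hashcode(k)\gg l)\bmod 2^W$. Nodes. An inode has one mutable field $main$, holding $null$, a cnode or an snode. A cnode has an integer bitmap $bmp$ of $2^W$ bits and an array of references to inodes or snodes; it is $k$-way if its array has length $k$. An snode has a key $k$, a value $v$ and a boolean $tomb$. Fields of cnodes and snodes are set only at creation. A mutable reference $root$ holds $null$ or an inode. For a cnode at level $l$, the entry for key $k$ exists iff bit $m(l,k)$ of $bmp$ is set, and is then $array(\#(((1\ll m(l,k))-1)\wedge bmp))$ ($\#$ = bit count, $\wedge$ = bitwise AND). Terminology. A null-inode is an inode with $main=null$; a tomb-inode is an inode whose $main$ is a tombed snode. A singleton is an snode or a tomb-inode. A tip is a cnode that contains at most one reference to a tomb-inode or snode, possibly some null-inodes, and no live inodes leading to cnodes; if its first ancestor cnode is $k$-way with $k>1$, the tip has length 1. Algorithm (restart means re-invoke the top-level operation). insert$(k,v)$: read $r=root$; if $r=null$ or $r$ is a null-inode, CAS $root$ from $r$ to a new inode whose $main$ is a new cnode containing only a new untombed snode $(k,v)$, restarting on failure; otherwise call iinsert$(r,k,v,0,null)$ and restart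 if it fails. iinsert$(i,k,v,lev,parent)$: read $cn=i.main$. If it is a cnode: if the flag for $m(lev,k)$ is unset, return the result of CAS $i.main$ from $cn$ to a copy of $cn$ with a new snode $(k,v)$ inserted; if the entry is an inode, recurse with level $lev+W$ and parent $i$; if the entry is an untombed snode $sn$ with $sn.k=k$, return the result of CAS $i.main$ from $cn$ to a copy with that entry replaced by a new snode $(k,v)$; if $sn.k\ne k$, return the result of CAS $i.main$ from $cn$ to a copy with that entry replaced by a new inode whose $main$ is a new cnode at level $lev+W$ containing $sn$ and a new snode $(k,v)$. If $i.main$ is a tombed snode or $null$: call clean$(parent)$ if $parent\ne null$, and fail. lookup$(k)$ / remove$(k)$: read $r=root$; if $r=null$ return NOTFOUND; if $r$ is a null-inode, CAS $root$ from $r$ to $null$ and restart; otherwise call ilookup$(r,k,0,null)$ / iremove$(r,k,0,null)$ and restart on RESTART. ilookup$(i,k,lev,parent)$: read $i.main$; if it is a cnode: return NOTFOUND if the flag is unset; recurse on an inode entry; on an untombed snode entry return its value if its key is $k$, else NOTFOUND. If $i.main$ is a tombed snode or $null$: clean$(parent)$ if $parent\ne null$, return RESTART. iremove$(i,k,lev,parent)$: as ilookup, except that on an untombed snode entry $sn$ with $sn.k=k$ it CASes $i.main$ from $cn$ to a copy without that entry (or to $null$ if $cn$ had a single entry), returning RESTART on failure; after a successful removal, if $parent\ne null$ it calls tombCompress$(i)$ and, if that returns true, contractParent$(parent,i,hashcode(k),lev-W)$, and returns $sn.v$. toCompressed$(cn)$: if $cn$ has exactly one entry and it is a tomb-inode,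 return its tombed snode; otherwise drop null-inode entries and replace tomb-inode entries by untombed copies of their snodes, returning the result if nonempty and $null$ otherwise. toWeakTombed$(cn)$: drop null-inode entries; if more than one entry remains return $cn$; if exactly one remains and it is a singleton return a tombed snode with its key and value; if exactly one remains otherwise return the one-entry cnode; if none remain return $null$. clean$(i)$: read $m=i.main$; if a cnode, CAS $i.main$ from $m$ to toCompressed$(m)$. tombCompress$(i)$: read $m=i.main$; if not a cnode return false; $w=$toWeakTombed$(m)$; if $w=m$ return false; CAS $i.main$ from $m$ to $w$; on success return true iff $w$ is $null$ or a tombed snode; on failure repeat. contractParent$(parent,i,hc,lev)$: read $m=i.main$ and $pm=parent.main$; if $pm$ is a cnode $cn$ whose entry for $hc$ at level $lev$ exists and equals $i$: if $m=null$ CAS $parent.main$ from $cn$ to $cn$ without that entry; if $m$ is a tombed snode CAS $parent.main$ from $cn$ to $cn$ with that entry replaced by an untombed copy; on CAS failure repeat; otherwise return. Memory is garbage-collected and new nodes are freshly allocated. *)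

theory Defs
  imports Main
begin

section \<open>Nodes and memory\<close>

text \<open>The value \<open>null\<close> of a mutable location is \<^const>\<open>None\<close>. The heap never shrinks and every
  allocation takes an unused reference; this is what fresh allocation together with garbage
  collection guarantees to a compare-and-swap, which compares references and not contents.\<close>

type_synonym ref = nat

datatype ('k, 'v) node =
    INode (main: "ref option")
  | CNode (bmp: nat) (arr: "ref list")
  | SNode (key: 'k) (val: 'v) (tomb: bool)

type_synonym ('k, 'v) heap = "ref \<Rightarrow> ('k, 'v) node option"

record ('k, 'v) memory =
  heap :: "('k, 'v) heap"
  rt :: "ref option"

definition alloc :: "('k, 'v) heap \<Rightarrow> ('k, 'v) node \<Rightarrow> ref \<Rightarrow> ('k, 'v) heap \<Rightarrow> bool" where
  "alloc h nd a h' \<longleftrightarrow> h a = None \<and> h' = h(a \<mapsto> nd)"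

definition cas_root ::
    "ref option \<Rightarrow> ref option \<Rightarrow> ('k, 'v) memory \<Rightarrow> bool \<times> ('k, 'v) memory" where
  "cas_root e n s = (if rt s = e then (True, s\<lparr>rt := n\<rparr>) else (False, s))"

definition cas_main ::
    "ref \<Rightarrow> ref option \<Rightarrow> ref option \<Rightarrow> ('k, 'v) memory \<Rightarrow> bool \<times> ('k, 'v) memory" where
  "cas_main i e n s =
     (if heap s i = Some (INode e) then (True, s\<lparr>heap := (heap s)(i \<mapsto> INode n)\<rparr>) else (False, s))"

definition tombed_snode :: "('k, 'v) heap \<Rightarrow> ref \<Rightarrow> bool" where
  "tombed_snode h x \<longleftrightarrow> (\<exists>k v. h x = Some (SNode k v True))"

definition null_inode :: "('k, 'v) heap \<Rightarrow> ref \<Rightarrow> bool" where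
  "null_inode h x \<longleftrightarrow> h x = Some (INode None)"

definition tomb_inode :: "('k, 'v) heap \<Rightarrow> ref \<Rightarrow> bool" where
  "tomb_inode h x \<longleftrightarrow> (\<exists>t. h x = Some (INode (Some t)) \<and> tombed_snode h t)"

definition live_inode :: "('k, 'v) heap \<Rightarrow> ref \<Rightarrow> bool" where
  "live_inode h x \<longleftrightarrow> (\<exists>c b xs. h x = Some (INode (Some c)) \<and> h c = Some (CNode b xs))"

definition singleton :: "('k, 'v) heap \<Rightarrow> ref \<Rightarrow> bool" where
  "singleton h x \<longleftrightarrow> (\<exists>k v t. h x = Some (SNode k v t)) \<or> tomb_inode h x"

definition null_or_tombed :: "('k, 'v) heap \<Rightarrow> ref option \<Rightarrow> bool" where
  "null_or_tombed h w \<longleftrightarrow> (case w of None \<Rightarrow> True | Some t \<Rightarrow> tombed_snode h t)"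


section \<open>Bitmaps and branching nodes\<close>

text \<open>Hashcodes are natural numbers, i.e. finite bit strings, padded with zeros on demand.\<close>

definition chunk :: "nat \<Rightarrow> ('k \<Rightarrow> nat) \<Rightarrow> nat \<Rightarrow> 'k \<Rightarrow> nat" where
  "chunk W hashcode l k = drop_bit l (hashcode k) mod 2 ^ W"

definition bit_count :: "nat \<Rightarrow> nat" where
  "bit_count n = card {j. bit n j}"

definition pos :: "nat \<Rightarrow> nat \<Rightarrow> nat" where
  "pos b m = bit_count (and (push_bit m 1 - 1) b)"

definition entry :: "nat \<Rightarrow> nat \<Rightarrow> ref list \<Rightarrow> ref option" where
  "entry m b xs = (if bit b m then Some (xs ! pos b m) else None)"

definition inserted :: "nat \<Rightarrow> ref \<Rightarrow> nat \<Rightarrow> ref list \<Rightarrow> ('k, 'v) node" where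
  "inserted m x b xs = CNode (set_bit m b) (take (pos b m) xs @ x # drop (pos b m) xs)"

definition replaced :: "nat \<Rightarrow> ref \<Rightarrow> nat \<Rightarrow> ref list \<Rightarrow> ('k, 'v) node" where
  "replaced m x b xs = CNode b (xs[pos b m := x])"

definition removed :: "nat \<Rightarrow> nat \<Rightarrow> ref list \<Rightarrow> ('k, 'v) node" where
  "removed m b xs = CNode (unset_bit m b) (take (pos b m) xs @ drop (Suc (pos b m)) xs)"

text \<open>The entries of a cnode paired with their bit positions, in array order.\<close>

definition entries :: "nat \<Rightarrow> ref list \<Rightarrow> (nat \<times> ref) list" where
  "entries b xs = zip (sorted_list_of_set {j. bit b j}) xs"

definition cnode_of :: "(nat \<times> ref) list \<Rightarrow> ('k, 'v) node" where
  "cnode_of es = CNode (foldr set_bit (map fst es) 0) (map snd es)"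

definition new_trie :: "nat \<Rightarrow> ('k \<Rightarrow> nat) \<Rightarrow> 'k \<Rightarrow> 'v \<Rightarrow>
    ('k, 'v) heap \<Rightarrow> ref \<Rightarrow> ('k, 'v) heap \<Rightarrow> bool" where
  "new_trie W hc k v h i h' \<longleftrightarrow> (\<exists>x h1 c h2.
     alloc h (SNode k v False) x h1 \<and>
     alloc h1 (cnode_of [(chunk W hc 0 k, x)]) c h2 \<and>
     alloc h2 (INode (Some c)) i h')"

text \<open>\<open>fork W hc k x k' x' lev h c h'\<close>: from heap \<open>h\<close>, allocation of a cnode \<open>c\<close> at level \<open>lev\<close>
  containing the snodes \<open>x\<close> (with key \<open>k\<close>) and \<open>x'\<close> (with key \<open>k'\<close>) results in \<open>h'\<close>. If the two
  hashcode chunks agree at \<open>lev\<close>, one entry must hold both snodes, so they are pushed down through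
  new inodes until the chunks differ. For keys with equal hashcodes this does not terminate: there
  is no derivation, and the inserting thread is stuck.\<close>

inductive fork :: "nat \<Rightarrow> ('k \<Rightarrow> nat) \<Rightarrow> 'k \<Rightarrow> ref \<Rightarrow> 'k \<Rightarrow> ref \<Rightarrow> nat \<Rightarrow>
    ('k, 'v) heap \<Rightarrow> ref \<Rightarrow> ('k, 'v) heap \<Rightarrow> bool"
  for W hc k x k' x' where
  differ: "fork W hc k x k' x' lev h c h'"
  if "chunk W hc lev k \<noteq> chunk W hc lev k'"
    and "es = (if chunk W hc lev k < chunk W hc lev k'
               then [(chunk W hc lev k, x), (chunk W hc lev k', x')]
               else [(chunk W hc lev k', x'), (chunk W hc lev k, x)])"
    and "alloc h (cnode_of es) c h'"
| agree: "fork W hc k x k' x' lev h c h'"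
  if "chunk W hc lev k = chunk W hc lev k'"
    and "fork W hc k x k' x' (lev + W) h c1 h1"
    and "alloc h1 (INode (Some c1)) i h2"
    and "alloc h2 (cnode_of [(chunk W hc lev k, i)]) c h'"


section \<open>Control states of a thread\<close>

datatype ('k, 'v) operation = Insert 'k 'v | Lookup 'k | Remove 'k

fun op_key :: "('k, 'v) operation \<Rightarrow> 'k" where
  "op_key (Insert k v) = k"
| "op_key (Lookup k) = k"
| "op_key (Remove k) = k"

datatype 'v result = Inserted | Found 'v | NotFound

text \<open>In every control state below, \<open>i lev anc\<close> stands for an invocation of iinsert, ilookup or
  iremove on inode \<open>i\<close> at level \<open>lev\<close>, together with the invocations that called it: \<open>anc\<close> lists
  the inodes of the latter, innermost first, at levels \<open>lev - W\<close>, \<open>lev - 2 W\<close>, and so on. So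
  \<open>parent\<close> is \<open>hd anc\<close>, and it is \<open>null\<close> iff \<open>anc = []\<close>. Each state is a program point right before
  at most one read of, or CAS on, a mutable location. The lists of pairs in the states that
  evaluate toCompressed and toWeakTombed are the entries already processed and those yet to be
  processed. Arguments of type \<^typ>\<open>'v\<close> are the removed value.\<close>

datatype 'v ctl =
    Start
  | TestRoot ref
  | CasRoot "ref option" "ref option"
  | Visit ref nat "ref list"
  | InsertCas ref ref "ref option"
  | RemoveCas ref ref "ref option" nat "ref list" 'v
  | Clean ref
  | ToCompressed ref ref
  | CompressFilter ref ref "(nat \<times> ref) list" "(nat \<times> ref) list"
  | CompressMap ref ref "(nat \<times> ref) list" "(nat \<times> ref) list"
  | CleanCas ref ref "ref option"
  | TombCompress ref nat "ref list" 'v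
  | TombFilter ref ref "(nat \<times> ref) list" "(nat \<times> ref) list" nat "ref list" 'v
  | TombCas ref ref "ref option" nat "ref list" 'v
  | Contract ref nat "ref list" 'v
  | ContractParent ref "ref option" nat "ref list" 'v
  | ContractCas ref ref ref nat "ref list" 'v

datatype 'v outcome = Continue "'v ctl" | Return "'v result"

text \<open>A failed iinsert, ilookup or iremove cleans the parent, if there is one, and then makes the
  top-level operation restart.\<close>

fun give_up :: "ref list \<Rightarrow> 'v ctl" where
  "give_up [] = Start"
| "give_up (p # anc) = Clean p"

text \<open>In an invocation of iremove, the key has been removed, either by this invocation or by the one
  it has called: unless \<open>parent\<close> is \<open>null\<close>, it remains to compress \<open>i\<close> and possibly contract
  \<open>parent\<close>. Once that is done, control is back in the calling invocation, for which the same holds.\<close>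

definition after_removal :: "'v \<Rightarrow> ref \<Rightarrow> nat \<Rightarrow> ref list \<Rightarrow> 'v outcome" where
  "after_removal v i lev anc =
     (if anc = [] then Return (Found v) else Continue (TombCompress i lev anc v))"

fun to_caller :: "nat \<Rightarrow> 'v \<Rightarrow> nat \<Rightarrow> ref list \<Rightarrow> 'v outcome" where
  "to_caller W v lev [] = Return (Found v)"
| "to_caller W v lev (p # anc) = after_removal v p (lev - W) anc"


section \<open>Atomic steps of one thread\<close>

inductive step :: "nat \<Rightarrow> ('k \<Rightarrow> nat) \<Rightarrow> ('k, 'v) operation \<Rightarrow>
    ('k, 'v) memory \<Rightarrow> 'v ctl \<Rightarrow> ('k, 'v) memory \<Rightarrow> 'v outcome \<Rightarrow> bool"
  for W hc opn where

\<comment> \<open>insert, lookup, remove\<close>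
  start_nonnull:
  "step W hc opn s Start s (Continue (TestRoot r))"
  if "rt s = Some r"
| start_null_insert:
  "step W hc opn s Start (s\<lparr>heap := h\<rparr>) (Continue (CasRoot None (Some i)))"
  if "rt s = None" and "opn = Insert k v" and "new_trie W hc k v (heap s) i h"
| start_null_other:
  "step W hc opn s Start s (Return NotFound)"
  if "rt s = None" and "\<forall>k v. opn \<noteq> Insert k v"
| test_null_insert:
  "step W hc opn s (TestRoot r) (s\<lparr>heap := h\<rparr>) (Continue (CasRoot (Some r) (Some i)))"
  if "null_inode (heap s) r" and "opn = Insert k v" and "new_trie W hc k v (heap s) i h"
| test_null_other:
  "step W hc opn s (TestRoot r) s (Continue (CasRoot (Some r) None))"
  if "null_inode (heap s) r" and "\<forall>k v. opn \<noteq> Insert k v"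
| test_nonnull:
  "step W hc opn s (TestRoot r) s (Continue (Visit r 0 []))"
  if "\<not> null_inode (heap s) r"
| cas_root_insert:
  "step W hc opn s (CasRoot e n) s' (if b then Return Inserted else Continue Start)"
  if "opn = Insert k v" and "cas_root e n s = (b, s')"
| cas_root_other:
  "step W hc opn s (CasRoot e n) s' (Continue Start)"
  if "\<forall>k v. opn \<noteq> Insert k v" and "cas_root e n s = (b, s')"

\<comment> \<open>iinsert, ilookup, iremove\<close>
| visit_dead:
  "step W hc opn s (Visit i lev anc) s (Continue (give_up anc))"
  if "heap s i = Some (INode w)" and "null_or_tombed (heap s) w"
| visit_inode:
  "step W hc opn s (Visit i lev anc) s (Continue (Visit x (lev + W) (i # anc)))"
  if "heap s i = Some (INode (Some c))" and "heap s c = Some (CNode b xs)"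
    and "entry (chunk W hc lev (op_key opn)) b xs = Some x"
    and "heap s x = Some (INode w)"
| insert_new:
  "step W hc opn s (Visit i lev anc) (s\<lparr>heap := h2\<rparr>) (Continue (InsertCas i c (Some c')))"
  if "opn = Insert k v"
    and "heap s i = Some (INode (Some c))" and "heap s c = Some (CNode b xs)"
    and "entry (chunk W hc lev k) b xs = None"
    and "alloc (heap s) (SNode k v False) y h1"
    and "alloc h1 (inserted (chunk W hc lev k) y b xs) c' h2"
| insert_same_key:
  "step W hc opn s (Visit i lev anc) (s\<lparr>heap := h2\<rparr>) (Continue (InsertCas i c (Some c')))"
  if "opn = Insert k v"
    and "heap s i = Some (INode (Some c))" and "heap s c = Some (CNode b xs)"
    and "entry (chunk W hc lev k) b xs = Some x"
    and "heap s x = Some (SNode k u False)"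
    and "alloc (heap s) (SNode k v False) y h1"
    and "alloc h1 (replaced (chunk W hc lev k) y b xs) c' h2"
| insert_other_key:
  "step W hc opn s (Visit i lev anc) (s\<lparr>heap := h4\<rparr>) (Continue (InsertCas i c (Some c')))"
  if "opn = Insert k v"
    and "heap s i = Some (INode (Some c))" and "heap s c = Some (CNode b xs)"
    and "entry (chunk W hc lev k) b xs = Some x"
    and "heap s x = Some (SNode k' u False)" and "k' \<noteq> k"
    and "alloc (heap s) (SNode k v False) y h1"
    and "fork W hc k' x k y (lev + W) h1 d h2"
    and "alloc h2 (INode (Some d)) j h3"
    and "alloc h3 (replaced (chunk W hc lev k) j b xs) c' h4"
| insert_cas:
  "step W hc opn s (InsertCas i c n) s' (if b then Return Inserted else Continue Start)"
  if "cas_main i (Some c) n s = (b, s')"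
| absent:
  "step W hc opn s (Visit i lev anc) s (Return NotFound)"
  if "\<forall>k v. opn \<noteq> Insert k v"
    and "heap s i = Some (INode (Some c))" and "heap s c = Some (CNode b xs)"
    and "entry (chunk W hc lev (op_key opn)) b xs = None"
| mismatch:
  "step W hc opn s (Visit i lev anc) s (Return NotFound)"
  if "\<forall>k v. opn \<noteq> Insert k v"
    and "heap s i = Some (INode (Some c))" and "heap s c = Some (CNode b xs)"
    and "entry (chunk W hc lev (op_key opn)) b xs = Some x"
    and "heap s x = Some (SNode k' u False)" and "k' \<noteq> op_key opn"
| lookup_found:
  "step W hc opn s (Visit i lev anc) s (Return (Found u))"
  if "opn = Lookup k"
    and "heap s i = Some (INode (Some c))" and "heap s c = Some (CNode b xs)"
    and "entry (chunk W hc lev k) b xs = Some x"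
    and "heap s x = Some (SNode k u False)"
| remove_only_entry:
  "step W hc opn s (Visit i lev anc) s (Continue (RemoveCas i c None lev anc u))"
  if "opn = Remove k"
    and "heap s i = Some (INode (Some c))" and "heap s c = Some (CNode b xs)"
    and "entry (chunk W hc lev k) b xs = Some x"
    and "heap s x = Some (SNode k u False)" and "length xs = 1"
| remove_entry:
  "step W hc opn s (Visit i lev anc) (s\<lparr>heap := h\<rparr>)
     (Continue (RemoveCas i c (Some c') lev anc u))"
  if "opn = Remove k"
    and "heap s i = Some (INode (Some c))" and "heap s c = Some (CNode b xs)"
    and "entry (chunk W hc lev k) b xs = Some x"
    and "heap s x = Some (SNode k u False)" and "length xs \<noteq> 1"
    and "alloc (heap s) (removed (chunk W hc lev k) b xs) c' h"
| remove_cas: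
  "step W hc opn s (RemoveCas i c n lev anc u) s'
     (if b then after_removal u i lev anc else Continue Start)"
  if "cas_main i (Some c) n s = (b, s')"

\<comment> \<open>clean and toCompressed\<close>
| clean_cnode:
  "step W hc opn s (Clean p) s (Continue (ToCompressed p c))"
  if "heap s p = Some (INode (Some c))" and "heap s c = Some (CNode b xs)"
| clean_other:
  "step W hc opn s (Clean p) s (Continue Start)"
  if "\<not> live_inode (heap s) p"
| compress_single:
  "step W hc opn s (ToCompressed p c) s (Continue (CleanCas p c (Some t)))"
  if "heap s c = Some (CNode b [x])"
    and "heap s x = Some (INode (Some t))" and "tombed_snode (heap s) t"
| compress_begin:
  "step W hc opn s (ToCompressed p c) s (Continue (CompressFilter p c [] (entries b xs)))"
  if "heap s c = Some (CNode b xs)" and "\<not> (\<exists>x. xs = [x] \<and> tomb_inode (heap s) x)"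
| compress_filter:
  "step W hc opn s (CompressFilter p c ds (e # es)) s
     (Continue (CompressFilter p c (if null_inode (heap s) (snd e) then ds else ds @ [e]) es))"
| compress_filtered:
  "step W hc opn s (CompressFilter p c ds []) s (Continue (CompressMap p c [] ds))"
| compress_resurrect:
  "step W hc opn s (CompressMap p c ds ((j, x) # es)) (s\<lparr>heap := h\<rparr>)
     (Continue (CompressMap p c (ds @ [(j, y)]) es))"
  if "heap s x = Some (INode (Some t))" and "heap s t = Some (SNode k u True)"
    and "alloc (heap s) (SNode k u False) y h"
| compress_keep:
  "step W hc opn s (CompressMap p c ds (e # es)) s (Continue (CompressMap p c (ds @ [e]) es))"
  if "\<not> tomb_inode (heap s) (snd e)"
| compress_empty:
  "step W hc opn s (CompressMap p c [] []) s (Continue (CleanCas p c None))"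
| compress_nonempty:
  "step W hc opn s (CompressMap p c ds []) (s\<lparr>heap := h\<rparr>) (Continue (CleanCas p c (Some c')))"
  if "ds \<noteq> []" and "alloc (heap s) (cnode_of ds) c' h"
| clean_cas:
  "step W hc opn s (CleanCas p c n) s' (Continue Start)"
  if "cas_main p (Some c) n s = (b, s')"

\<comment> \<open>tombCompress and toWeakTombed\<close>
| tomb_read_cnode:
  "step W hc opn s (TombCompress i lev anc v) s
     (Continue (TombFilter i c [] (entries b xs) lev anc v))"
  if "heap s i = Some (INode (Some c))" and "heap s c = Some (CNode b xs)"
| tomb_read_other:
  "step W hc opn s (TombCompress i lev anc v) s (to_caller W v lev anc)"
  if "\<not> live_inode (heap s) i"
| tomb_filter:
  "step W hc opn s (TombFilter i c ds (e # es) lev anc v) s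
     (Continue
       (TombFilter i c (if null_inode (heap s) (snd e) then ds else ds @ [e]) es lev anc v))"
| tomb_unchanged:
  "step W hc opn s (TombFilter i c ds [] lev anc v) s (to_caller W v lev anc)"
  if "length ds > 1"
| tomb_null:
  "step W hc opn s (TombFilter i c [] [] lev anc v) s (Continue (TombCas i c None lev anc v))"
| tomb_snode:
  "step W hc opn s (TombFilter i c [(j, x)] [] lev anc v) (s\<lparr>heap := h\<rparr>)
     (Continue (TombCas i c (Some t) lev anc v))"
  if "heap s x = Some (SNode k u b)"
    and "alloc (heap s) (SNode k u True) t h"
| tomb_tomb_inode:
  "step W hc opn s (TombFilter i c [(j, x)] [] lev anc v) (s\<lparr>heap := h\<rparr>)
     (Continue (TombCas i c (Some t) lev anc v))"
  if "heap s x = Some (INode (Some z))" and "heap s z = Some (SNode k u True)"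
    and "alloc (heap s) (SNode k u True) t h"
| tomb_nonsingleton:
  "step W hc opn s (TombFilter i c [(j, x)] [] lev anc v) (s\<lparr>heap := h\<rparr>)
     (Continue (TombCas i c (Some c') lev anc v))"
  if "\<not> singleton (heap s) x"
    and "alloc (heap s) (cnode_of [(j, x)]) c' h"
| tomb_cas_success:
  "step W hc opn s (TombCas i c w lev anc v) s'
     (if null_or_tombed (heap s) w then Continue (Contract i lev anc v) else to_caller W v lev anc)"
  if "cas_main i (Some c) w s = (True, s')"
| tomb_cas_failure:
  "step W hc opn s (TombCas i c w lev anc v) s' (Continue (TombCompress i lev anc v))"
  if "cas_main i (Some c) w s = (False, s')"

\<comment> \<open>contractParent\<close>
| contract_read:
  "step W hc opn s (Contract i lev anc v) s (Continue (ContractParent i m lev anc v))"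
  if "heap s i = Some (INode m)"
| contract_null:
  "step W hc opn s (ContractParent i None lev (p # anc) v) (s\<lparr>heap := h\<rparr>)
     (Continue (ContractCas i c c' lev (p # anc) v))"
  if "heap s p = Some (INode (Some c))" and "heap s c = Some (CNode b xs)"
    and "entry (chunk W hc (lev - W) (op_key opn)) b xs = Some i"
    and "alloc (heap s) (removed (chunk W hc (lev - W) (op_key opn)) b xs) c' h"
| contract_tombed:
  "step W hc opn s (ContractParent i (Some t) lev (p # anc) v) (s\<lparr>heap := h2\<rparr>)
     (Continue (ContractCas i c c' lev (p # anc) v))"
  if "heap s p = Some (INode (Some c))" and "heap s c = Some (CNode b xs)"
    and "entry (chunk W hc (lev - W) (op_key opn)) b xs = Some i"
    and "heap s t = Some (SNode k u True)"
    and "alloc (heap s) (SNode k u False) y h1"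
    and "alloc h1 (replaced (chunk W hc (lev - W) (op_key opn)) y b xs) c' h2"
| contract_none:
  "step W hc opn s (ContractParent i m lev (p # anc) v) s (to_caller W v lev (p # anc))"
  if "\<not> (\<exists>c b xs. heap s p = Some (INode (Some c)) \<and> heap s c = Some (CNode b xs) \<and>
            entry (chunk W hc (lev - W) (op_key opn)) b xs = Some i \<and> null_or_tombed (heap s) m)"
| contract_cas:
  "step W hc opn s (ContractCas i c c' lev (p # anc) v) s'
     (if b then to_caller W v lev (p # anc) else Continue (Contract i lev (p # anc) v))"
  if "cas_main p (Some c) (Some c') s = (b, s')"


section \<open>Executions\<close>

datatype ('k, 'v) thread = Idle | Busy "('k, 'v) operation" "'v ctl"

type_synonym ('t, 'k, 'v) config = "('k, 'v) memory \<times> ('t \<Rightarrow> ('k, 'v) thread)"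

definition initial :: "('t, 'k, 'v) config" where
  "initial = (\<lparr>heap = Map.empty, rt = None\<rparr>, \<lambda>_. Idle)"

inductive sys_step :: "nat \<Rightarrow> ('k \<Rightarrow> nat) \<Rightarrow>
    ('t, 'k, 'v) config \<Rightarrow> ('t, 'k, 'v) config \<Rightarrow> bool"
  for W hc where
  invoke: "sys_step W hc (s, T) (s, T(t := Busy opn Start))"
  if "T t = Idle"
| proceed: "sys_step W hc (s, T) (s', T(t := Busy opn c'))"
  if "T t = Busy opn c" and "step W hc opn s c s' (Continue c')"
| complete: "sys_step W hc (s, T) (s', T(t := Idle))"
  if "T t = Busy opn c" and "step W hc opn s c s' (Return r)"

definition reachable :: "nat \<Rightarrow> ('k \<Rightarrow> nat) \<Rightarrow> ('t, 'k, 'v) config \<Rightarrow> bool" where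
  "reachable W hc \<sigma> \<longleftrightarrow> (sys_step W hc)\<^sup>*\<^sup>* initial \<sigma>"

definition removes_completed :: "('t, 'k, 'v) config \<Rightarrow> bool" where
  "removes_completed \<sigma> \<longleftrightarrow> (\<forall>t k c. snd \<sigma> t \<noteq> Busy (Remove k) c)"


section \<open>Tips\<close>

inductive in_trie :: "('k, 'v) memory \<Rightarrow> ref \<Rightarrow> bool" for s where
  "in_trie s r" if "rt s = Some r"
| "in_trie s m" if "in_trie s i" and "heap s i = Some (INode (Some m))"
| "in_trie s x" if "in_trie s c" and "heap s c = Some (CNode b xs)" and "x \<in> set xs"

definition k_way :: "('k, 'v) heap \<Rightarrow> nat \<Rightarrow> ref \<Rightarrow> bool" where
  "k_way h n c \<longleftrightarrow> (\<exists>b xs. h c = Some (CNode b xs) \<and> length xs = n)"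

definition tip :: "('k, 'v) heap \<Rightarrow> ref \<Rightarrow> bool" where
  "tip h c \<longleftrightarrow> (\<exists>b xs. h c = Some (CNode b xs) \<and>
     length (filter (singleton h) xs) \<le> 1 \<and>
     (\<forall>x\<in>set xs. \<not> live_inode h x))"

text \<open>The nearest ancestor: \<open>c\<close> is the content of an inode that is an entry of \<open>p\<close>.\<close>

definition first_ancestor_cnode :: "('k, 'v) heap \<Rightarrow> ref \<Rightarrow> ref \<Rightarrow> bool" where
  "first_ancestor_cnode h p c \<longleftrightarrow>
     (\<exists>b xs. h p = Some (CNode b xs) \<and> (\<exists>i\<in>set xs. h i = Some (INode (Some c))))"

definition tip_of_length_1 :: "('k, 'v) memory \<Rightarrow> ref \<Rightarrow> bool" where
  "tip_of_length_1 s c \<longleftrightarrow> in_trie s c \<and> tip (heap s) c \<and>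
     (\<exists>p n. in_trie s p \<and> first_ancestor_cnode (heap s) p c \<and> k_way (heap s) n p \<and> n > 1)"

end

theory Submission
  imports Defs
begin

text \<open>In fact there is no tip of length 1 once all removes have completed. The invariant is: whenever an
  inode below the root leads to a cnode with no live inodes and at most one singleton among its
  entries, some thread executing a remove still has to run tombCompress on that inode from its
  beginning, or is in the middle of a run that is bound either to kill the inode or to start over.
  A cnode gets into this state when a remove deletes one of its entries, or when the content of an
  entry dies. In the second case, the entry was killed by a remove, which proceeds to the
  parent, or by a clean; a clean kills only an inode that was in this state itself, so a
  remove was on its way to that inode and will go on to the parent. All other writes keep an inode
  out of this state, as they never lower the number of live entries and singletons.\<close>

section \<open>Bitmaps\<close>

text \<open>The obstacle is that whatever a thread has read may be stale when it acts: tombCompress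
  and clean inspect entries one at a time while other threads empty them. Two facts compensate.
  Cnodes are immutable and a replaced cnode never returns to its inode, so a successful CAS
  certifies that the array read earlier is still current. And an inode changes its status in one
  direction only, from live to null or tombed, so the weights 0, 1, 2 turn each inspection into an
  inequality that holds in all later heaps; the value 2 lets a single live inode exceed the bound 1.
  Handing an obligation from an inode to its parent requires the parent to lie on the call stack of
  the responsible remove. Hence the ghost parent \<open>g\<close>, which never changes on allocated
  references and which all call stacks follow, even after an inode has been cut off from the trie.
  Root inodes are exempt throughout: they have no parent, and tombCompress is never run on
  them.\<close>

lemma finite_bits: "finite {j. bit (n::nat) j}"
proof (rule finite_subset)
  show "{j. bit n j} \<subseteq> {..<n}"
  proof
    fix j assume "j \<in> {j. bit n j}"
    then have "n div 2 ^ j \<noteq> 0" by (auto simp: bit_iff_odd elim: oddE)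
    then have "2 ^ j \<le> n" by (simp add: div_eq_0_iff)
    then show "j \<in> {..<n}" using less_le_trans[OF less_exp] by auto
  qed
qed simp

lemma pos_eq_card: "pos b m = card {j. j < m \<and> bit b j}"
proof -
  have "and (push_bit m 1 - 1) b = take_bit m b"
    by (simp add: take_bit_eq_mask mask_eq_exp_minus_1 push_bit_eq_mult and.commute)
  then show ?thesis by (simp add: pos_def bit_count_def bit_take_bit_iff)
qed

lemma pos_less_card:
  assumes "bit b m" shows "pos b m < card {j. bit b j}"
  unfolding pos_eq_card
  by (rule psubset_card_mono) (use assms finite_bits in auto)

text \<open>Makes \<open>pos b m\<close> a valid index whenever bit \<open>m\<close> of
  \<open>b\<close> is set, so that \<open>entry\<close> never applies \<open>!\<close> out of
  range.\<close>

definition wf_cnode :: "nat \<Rightarrow> ref list \<Rightarrow> bool" where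
  "wf_cnode b xs \<longleftrightarrow> card {j. bit b j} = length xs"

lemma entry_SomeD:
  assumes "wf_cnode b xs" "entry m b xs = Some x"
  shows "bit b m" "pos b m < length xs" "x = xs ! pos b m" "x \<in> set xs"
proof -
  show *: "bit b m" "x = xs ! pos b m"
    using assms(2) by (auto simp: entry_def split: if_splits)
  show "pos b m < length xs"
    using * pos_less_card[of b m] assms(1) by (simp add: wf_cnode_def)
  with * show "x \<in> set xs" by simp
qed

lemma wf_inserted:
  assumes "wf_cnode b xs" "entry m b xs = None" "inserted m x b xs = CNode b' ys"
  shows "wf_cnode b' ys"
proof -
  have nb: "\<not> bit b m" using assms(2) by (auto simp: entry_def split: if_splits)
  have "{j. bit (set_bit m b) j} = insert m {j. bit b j}"
    by (auto simp: bit_set_bit_iff)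
  then have "card {j. bit (set_bit m b) j} = Suc (card {j. bit b j})"
    using nb finite_bits[of b] by simp
  then show ?thesis using assms by (auto simp: wf_cnode_def inserted_def)
qed

lemma wf_removed:
  assumes "wf_cnode b xs" "entry m b xs = Some x" "removed m b xs = CNode b' ys"
  shows "wf_cnode b' ys"
proof -
  note e = entry_SomeD[OF assms(1,2)]
  have "{j. bit (unset_bit m b) j} = {j. bit b j} - {m}"
    by (auto simp: bit_unset_bit_iff)
  then have "card {j. bit (unset_bit m b) j} = card {j. bit b j} - 1"
    using e(1) finite_bits[of b] by (simp add: card_Diff_singleton)
  then show ?thesis using assms e(2) by (auto simp: wf_cnode_def removed_def)
qed

lemma wf_cnode_of:
  assumes "distinct (map fst es)" "cnode_of es = CNode b ys"
  shows "wf_cnode b ys"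
proof -
  have "{j. bit (foldr set_bit ms (0::nat)) j} = set ms" for ms
    by (induction ms) (auto simp: bit_set_bit_iff)
  from this[of "map fst es"] have "{j. bit b j} = set (map fst es)"
    using assms(2) by (simp add: cnode_of_def)
  then show ?thesis using assms
    by (auto simp: wf_cnode_def cnode_of_def distinct_card simp del: set_map)
qed

text \<open>The \<open>zip\<close> in \<open>entries\<close> would silently drop surplus elements;
  \<open>wf_cnode\<close> makes both lists equally long.\<close>

lemma entries_wf:
  assumes "wf_cnode b xs"
  shows "map snd (entries b xs) = xs" "distinct (map fst (entries b xs))"
  using assms by (auto simp: wf_cnode_def entries_def map_snd_zip map_fst_zip)

section \<open>Weights and the evolution of the heap\<close>

text \<open>A cnode has no live inodes and at most one singleton iff its entries weigh at most 1 in
  total. Weights never increase over time, and weights 0 and 1 are final.\<close>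

definition weight :: "('k, 'v) heap \<Rightarrow> ref \<Rightarrow> nat" where
  "weight h x = (if null_inode h x then 0 else if singleton h x then 1 else 2)"

definition total_weight :: "('k, 'v) heap \<Rightarrow> ref list \<Rightarrow> nat" where
  "total_weight h xs = sum_list (map (weight h) xs)"

lemma total_weight_simps [simp]:
  "total_weight h [] = 0" "total_weight h (x # xs) = weight h x + total_weight h xs"
  "total_weight h (xs @ ys) = total_weight h xs + total_weight h ys"
  by (simp_all add: total_weight_def)

lemma total_weight_cong:
  "(\<And>x. x \<in> set xs \<Longrightarrow> weight h' x = weight h x) \<Longrightarrow> total_weight h' xs = total_weight h xs"
  unfolding total_weight_def by (metis map_cong)

lemma weight_le_total_weight: "x \<in> set xs \<Longrightarrow> weight h x \<le> total_weight h xs"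
  by (induction xs) auto

lemma total_weight_update:
  assumes "p < length xs"
  shows "total_weight h (xs[p := y]) + weight h (xs ! p) = total_weight h xs + weight h y"
proof -
  have *: "total_weight h (take p xs @ z # drop (Suc p) xs) =
      total_weight h (take p xs) + weight h z + total_weight h (drop (Suc p) xs)" for z
    by simp
  show ?thesis using *[of y] *[of "xs ! p"] assms
    by (simp add: upd_conv_take_nth_drop id_take_nth_drop[symmetric])
qed

text \<open>Bounds the entries that toWeakTombed can retain from a cnode of total weight at most
  1.\<close>

lemma length_nonnull_le_total_weight:
  "length (filter (\<lambda>e. \<not> null_inode h (snd e)) es) \<le> total_weight h (map snd es)"
  by (induction es) (auto simp: weight_def)

text \<open>Requiring that the replaced content is not a tombed snode, rather than that it is a cnode,
  makes this relation transitive even for heaps with dangling references.\<close>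

definition ext :: "('k, 'v) heap \<Rightarrow> ('k, 'v) heap \<Rightarrow> bool" where
  "ext h h' \<longleftrightarrow> (\<forall>x nd. h x = Some nd \<longrightarrow> h' x = Some nd \<or>
     (\<exists>c w. nd = INode (Some c) \<and> \<not> tombed_snode h c \<and> h' x = Some (INode w)))"

lemma ext_refl [simp]: "ext h h" by (simp add: ext_def)

lemma ext_CNode: "ext h h' \<Longrightarrow> h x = Some (CNode b xs) \<Longrightarrow> h' x = Some (CNode b xs)"
  by (fastforce simp: ext_def)

lemma ext_SNode: "ext h h' \<Longrightarrow> h x = Some (SNode k v b) \<Longrightarrow> h' x = Some (SNode k v b)"
  by (fastforce simp: ext_def)

lemma ext_INode: "ext h h' \<Longrightarrow> h x = Some (INode w) \<Longrightarrow> \<exists>w'. h' x = Some (INode w')"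
  by (fastforce simp: ext_def)

lemma ext_tombed: "ext h h' \<Longrightarrow> tombed_snode h t \<Longrightarrow> tombed_snode h' t"
  by (auto simp: tombed_snode_def dest: ext_SNode)

lemma ext_trans:
  assumes "ext h h'" "ext h' h''"
  shows "ext h h''"
  unfolding ext_def
proof (intro allI impI)
  fix x nd assume x: "h x = Some nd"
  then consider "h' x = Some nd" | c w where
    "nd = INode (Some c)" "\<not> tombed_snode h c" "h' x = Some (INode w)"
    using assms(1) unfolding ext_def by blast
  then show "h'' x = Some nd \<or>
     (\<exists>c w. nd = INode (Some c) \<and> \<not> tombed_snode h c \<and> h'' x = Some (INode w))"
  proof cases
    case 1
    \<comment> \<open>If \<open>x\<close> changes in the second period, the hypothesis only says
      that its content is not tombed in \<open>h'\<close>. Tombed snodes persist, so it was not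
      tombed in \<open>h\<close> either.\<close>
    then show ?thesis using assms ext_tombed[OF assms(1)] unfolding ext_def by blast
  next
    case 2
    then show ?thesis using ext_INode[OF assms(2)] by blast
  qed
qed

lemma ext_null: "ext h h' \<Longrightarrow> null_inode h x \<Longrightarrow> null_inode h' x"
  by (fastforce simp: ext_def null_inode_def)

lemma ext_tomb_inode:
  assumes "ext h h'" "tomb_inode h x"
  shows "tomb_inode h' x"
proof -
  obtain t where t: "h x = Some (INode (Some t))" "tombed_snode h t"
    using assms(2) by (auto simp: tomb_inode_def)
  then have "h' x = Some (INode (Some t))" using assms(1) by (auto simp: ext_def)
  with ext_tombed[OF assms(1) t(2)] show ?thesis by (auto simp: tomb_inode_def)
qed

lemma ext_singleton: "ext h h' \<Longrightarrow> singleton h x \<Longrightarrow> singleton h' x"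
  by (auto simp: singleton_def dest: ext_tomb_inode ext_SNode)

lemma not_null_singleton: "singleton h x \<Longrightarrow> \<not> null_inode h x"
  by (auto simp: singleton_def null_inode_def tomb_inode_def)

lemma weight_ext: "ext h h' \<Longrightarrow> weight h' x \<le> weight h x"
  using ext_null[of h h' x] ext_singleton[of h h' x] by (auto simp: weight_def)

lemma total_weight_ext: "ext h h' \<Longrightarrow> total_weight h' xs \<le> total_weight h xs"
  by (induction xs) (auto simp: weight_ext add_mono)

lemma weight_null: "ext h h' \<Longrightarrow> null_inode h x \<Longrightarrow> weight h' x = 0"
  by (simp add: weight_def ext_null)

lemma weight_single: "ext h h' \<Longrightarrow> singleton h x \<Longrightarrow> weight h' x = 1"
  using ext_singleton[of h h' x] not_null_singleton[of h' x] by (simp add: weight_def)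

lemma singleton_SNode: "h x = Some (SNode k v b) \<Longrightarrow> singleton h x"
  by (auto simp: singleton_def)

lemma singleton_tomb: "tomb_inode h x \<Longrightarrow> singleton h x"
  by (auto simp: singleton_def)

lemma weight_live: "live_inode h x \<Longrightarrow> weight h x = 2"
  by (auto simp: weight_def live_inode_def null_inode_def singleton_def tomb_inode_def tombed_snode_def)

section \<open>The invariant\<close>

definition inode :: "('k, 'v) heap \<Rightarrow> ref \<Rightarrow> bool" where
  "inode h x \<longleftrightarrow> (\<exists>w. h x = Some (INode w))"

definition snode :: "('k, 'v) heap \<Rightarrow> ref \<Rightarrow> bool" where
  "snode h x \<longleftrightarrow> (\<exists>k v b. h x = Some (SNode k v b))"

definition array_of :: "('k, 'v) heap \<Rightarrow> ref \<Rightarrow> ref list" where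
  "array_of h c = arr (the (h c))"

lemma array_of_CNode [simp]: "h c = Some (CNode b xs) \<Longrightarrow> array_of h c = xs"
  by (simp add: array_of_def)

text \<open>Ghost state: \<open>g\<close> maps a cnode to the only inode that it may ever be the content of, a non-root
  inode to its parent inode, and a root inode to itself; \<open>own\<close> maps a cnode that a thread has
  allocated as the new value of a pending CAS to that thread, and a published cnode to \<^const>\<open>None\<close>.\<close>

definition heap_inv :: "(ref \<Rightarrow> ref) \<Rightarrow> (ref \<Rightarrow> 't option) \<Rightarrow> ('k, 'v) heap \<Rightarrow> bool" where
  "heap_inv g own h \<longleftrightarrow>
     (\<forall>c b xs. h c = Some (CNode b xs) \<longrightarrow> wf_cnode b xs \<and>
        (\<forall>x\<in>set xs. snode h x \<or> inode h x \<and> g x = g c \<and> g x \<noteq> x)) \<and>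
     (\<forall>p m. h p = Some (INode (Some m)) \<longrightarrow>
        (\<exists>b xs. h m = Some (CNode b xs) \<and> g m = p \<and> own m = None) \<or> tombed_snode h m)"

lemma heap_inv_CNode:
  assumes "heap_inv g own h" "h c = Some (CNode b xs)"
  shows "wf_cnode b xs" "x \<in> set xs \<Longrightarrow> snode h x \<or> inode h x \<and> g x = g c \<and> g x \<noteq> x"
  using assms by (auto simp: heap_inv_def)

lemma heap_inv_INode:
  assumes "heap_inv g own h" "h p = Some (INode (Some m))"
  shows "(\<exists>b xs. h m = Some (CNode b xs) \<and> g m = p \<and> own m = None) \<or> tombed_snode h m"
  using assms by (auto simp: heap_inv_def)

lemma heap_inv_entry_dom:
  "heap_inv g own h \<Longrightarrow> h c = Some (CNode b xs) \<Longrightarrow> x \<in> set xs \<Longrightarrow> x \<in> dom h"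
  using heap_inv_CNode(2)[of g own h c b xs x] by (auto simp: snode_def inode_def)

text \<open>Unlike reachability from the root, this is permanent: it survives the replacement of
  \<open>d\<close>, and so applies to inodes that a thread still holds after they were cut
  off.\<close>

definition public_entry :: "(ref \<Rightarrow> 't option) \<Rightarrow> ('k, 'v) heap \<Rightarrow> ref \<Rightarrow> bool" where
  "public_entry own h x \<longleftrightarrow> (\<exists>d b xs. h d = Some (CNode b xs) \<and> x \<in> set xs \<and> own d = None)"

definition root_inode :: "(ref \<Rightarrow> ref) \<Rightarrow> ('k, 'v) heap \<Rightarrow> ref \<Rightarrow> bool" where
  "root_inode g h r \<longleftrightarrow> inode h r \<and> g r = r"

text \<open>Every CAS on an inode targets a visitable one. A freshly forked inode that occurs only
  in a pending cnode is not visitable, which protects it.\<close>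

definition visitable :: "(ref \<Rightarrow> ref) \<Rightarrow> (ref \<Rightarrow> 't option) \<Rightarrow> ('k, 'v) heap \<Rightarrow> ref \<Rightarrow> bool" where
  "visitable g own h x \<longleftrightarrow> inode h x \<and> (g x = x \<or> public_entry own h x)"

text \<open>The call stack is the complete ghost path up to a root. It speaks of \<open>g\<close>
  only, so no change of the heap can invalidate it.\<close>

fun chain :: "(ref \<Rightarrow> ref) \<Rightarrow> ref \<Rightarrow> ref list \<Rightarrow> bool" where
  "chain g i [] \<longleftrightarrow> g i = i"
| "chain g i (p # anc) \<longleftrightarrow> g i = p \<and> i \<noteq> p \<and> chain g p anc"

definition visitable_path :: "(ref \<Rightarrow> ref) \<Rightarrow> (ref \<Rightarrow> 't option) \<Rightarrow> ('k, 'v) heap \<Rightarrow> ref \<Rightarrow> ref list \<Rightarrow> bool" where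
  "visitable_path g own h i anc \<longleftrightarrow> (\<forall>x\<in>set (i # anc). visitable g own h x) \<and> chain g i anc"

text \<open>Does not ask that \<open>c\<close> is still the content of \<open>i\<close>: a thread
  may hold a stale cnode, and only its CAS reveals whether \<open>c\<close> is current.\<close>

definition public_cnode :: "(ref \<Rightarrow> ref) \<Rightarrow> (ref \<Rightarrow> 't option) \<Rightarrow> ('k, 'v) heap \<Rightarrow> ref \<Rightarrow> ref \<Rightarrow> bool" where
  "public_cnode g own h i c \<longleftrightarrow> (\<exists>b xs. h c = Some (CNode b xs)) \<and> g c = i \<and> own c = None"

definition private_cnode :: "(ref \<Rightarrow> ref) \<Rightarrow> (ref \<Rightarrow> 't option) \<Rightarrow> ('k, 'v) heap \<Rightarrow> 't \<Rightarrow> ref \<Rightarrow> ref \<Rightarrow> bool" where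
  "private_cnode g own h t i c \<longleftrightarrow> (\<exists>b xs. h c = Some (CNode b xs)) \<and> g c = i \<and> own c = Some t"

text \<open>A freshly forked inode cannot die before the cnode \<open>c\<close> containing it is published.\<close>

definition hidden_live :: "('k, 'v) heap \<Rightarrow> ref \<Rightarrow> ref \<Rightarrow> bool" where
  "hidden_live h c j \<longleftrightarrow> j \<in> set (array_of h c) \<and> weight h j = 2 \<and>
     (\<forall>d b xs. h d = Some (CNode b xs) \<and> j \<in> set xs \<longrightarrow> d = c)"

text \<open>The quantification over all future heaps makes this stable under the steps of other threads.\<close>

definition never_heavier :: "('k, 'v) heap \<Rightarrow> ref list \<Rightarrow> ref list \<Rightarrow> bool" where
  "never_heavier h xs ys \<longleftrightarrow> (\<forall>h'. ext h h' \<longrightarrow> total_weight h' xs \<le> total_weight h' ys)"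

text \<open>\<open>es\<close> consists of the processed and the pending part of an evaluation of
  toCompressed or toWeakTombed. The comparison is directed so that a light copy forces
  \<open>c\<close> to be light too. Distinct positions are what \<open>cnode_of\<close> needs to
  build a well-formed cnode.\<close>

definition partial_copy :: "('k, 'v) heap \<Rightarrow> ref \<Rightarrow> (nat \<times> ref) list \<Rightarrow> bool" where
  "partial_copy h c es \<longleftrightarrow> distinct (map fst es) \<and>
     (\<forall>e\<in>set es. snd e \<in> set (array_of h c) \<or> snode h (snd e)) \<and> never_heavier h (array_of h c) (map snd es)"

definition is_remove :: "('k, 'v) operation \<Rightarrow> bool" where
  "is_remove opn \<longleftrightarrow> (\<exists>k. opn = Remove k)"

text \<open>Pending CASes of an insert or a clean carry a weight comparison, a hidden live inode or
  the bound 1, because the thread takes on no obligation afterwards. \<open>RemoveCas\<close>,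
  \<open>ContractCas\<close> and a killing \<open>TombCas\<close> carry nothing of the kind: that
  thread goes on to tombCompress the non-root inode that may have become light.\<close>

fun ctl_inv :: "(ref \<Rightarrow> ref) \<Rightarrow> (ref \<Rightarrow> 't option) \<Rightarrow> ('k, 'v) heap \<Rightarrow> 't \<Rightarrow>
    ('k, 'v) operation \<Rightarrow> 'v ctl \<Rightarrow> bool" where
  "ctl_inv g own h t opn Start \<longleftrightarrow> True"
| "ctl_inv g own h t opn (TestRoot r) \<longleftrightarrow> root_inode g h r"
| "ctl_inv g own h t opn (CasRoot e n) \<longleftrightarrow> (\<forall>i. n = Some i \<longrightarrow> root_inode g h i)"
| "ctl_inv g own h t opn (Visit i lev anc) \<longleftrightarrow> visitable_path g own h i anc"
| "ctl_inv g own h t opn (InsertCas i c n) \<longleftrightarrow> visitable g own h i \<and> public_cnode g own h i c \<and>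
     (\<exists>c'. n = Some c' \<and> private_cnode g own h t i c' \<and>
        (never_heavier h (array_of h c) (array_of h c') \<or> (\<exists>j. hidden_live h c' j)))"
| "ctl_inv g own h t opn (RemoveCas i c n lev anc u) \<longleftrightarrow> is_remove opn \<and> visitable_path g own h i anc \<and>
     public_cnode g own h i c \<and> (\<forall>c'. n = Some c' \<longrightarrow> private_cnode g own h t i c')"
| "ctl_inv g own h t opn (Clean p) \<longleftrightarrow> visitable g own h p"
| "ctl_inv g own h t opn (ToCompressed p c) \<longleftrightarrow> visitable g own h p \<and> public_cnode g own h p c"
| "ctl_inv g own h t opn (CompressFilter p c ds es) \<longleftrightarrow> visitable g own h p \<and> public_cnode g own h p c \<and>
     partial_copy h c (ds @ es)"
| "ctl_inv g own h t opn (CompressMap p c ds es) \<longleftrightarrow> visitable g own h p \<and> public_cnode g own h p c \<and>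
     partial_copy h c (ds @ es)"
| "ctl_inv g own h t opn (CleanCas p c n) \<longleftrightarrow> visitable g own h p \<and> public_cnode g own h p c \<and>
     (null_or_tombed h n \<and> total_weight h (array_of h c) \<le> 1 \<or>
      (\<exists>c'. n = Some c' \<and> private_cnode g own h t p c' \<and> never_heavier h (array_of h c) (array_of h c')))"
| "ctl_inv g own h t opn (TombCompress i lev anc v) \<longleftrightarrow> is_remove opn \<and> visitable_path g own h i anc"
| "ctl_inv g own h t opn (TombFilter i c ds es lev anc v) \<longleftrightarrow> is_remove opn \<and> visitable_path g own h i anc \<and>
     public_cnode g own h i c \<and> partial_copy h c (ds @ es)"
| "ctl_inv g own h t opn (TombCas i c w lev anc v) \<longleftrightarrow> is_remove opn \<and> visitable_path g own h i anc \<and>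
     public_cnode g own h i c \<and>
     (null_or_tombed h w \<or>
      (\<exists>c'. w = Some c' \<and> private_cnode g own h t i c' \<and> never_heavier h (array_of h c) (array_of h c')))"
| "ctl_inv g own h t opn (Contract i lev anc v) \<longleftrightarrow> is_remove opn \<and> visitable_path g own h i anc"
| "ctl_inv g own h t opn (ContractParent i m lev anc v) \<longleftrightarrow> is_remove opn \<and> visitable_path g own h i anc"
| "ctl_inv g own h t opn (ContractCas i c c' lev anc v) \<longleftrightarrow> is_remove opn \<and> visitable_path g own h i anc \<and>
     (\<exists>p anc'. anc = p # anc' \<and> public_cnode g own h p c \<and> private_cnode g own h t p c')"

text \<open>A run of tombCompress on the cnode \<open>c\<close> counts if it cannot leave with an unchanged \<open>c\<close> (it retains
  at most one entry) and cannot replace \<open>c\<close> by another cnode (a retained entry is not a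
  null-inode). If \<open>c\<close> has been replaced in the meantime, then the CAS fails and the run starts over.\<close>

fun will_compress :: "('k, 'v) heap \<Rightarrow> ref \<Rightarrow> 'v ctl \<Rightarrow> bool" where
  "will_compress h p (TombCompress i lev anc v) \<longleftrightarrow> p = i \<or> p \<in> set anc"
| "will_compress h p (TombFilter i c ds es lev anc v) \<longleftrightarrow> p \<in> set anc \<or>
     p = i \<and> length ds + length (filter (\<lambda>e. \<not> null_inode h (snd e)) es) \<le> 1 \<and>
     (h i = Some (INode (Some c)) \<longrightarrow> (\<forall>e\<in>set ds. \<not> null_inode h (snd e)))"
| "will_compress h p (TombCas i c w lev anc v) \<longleftrightarrow> p \<in> set anc \<or>
     p = i \<and> (h i = Some (INode (Some c)) \<longrightarrow> null_or_tombed h w)"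
| "will_compress h p (Contract i lev anc v) \<longleftrightarrow> p \<in> set anc"
| "will_compress h p (ContractParent i m lev anc v) \<longleftrightarrow> p \<in> set anc"
| "will_compress h p (ContractCas i c c' lev anc v) \<longleftrightarrow> p \<in> set anc"
| "will_compress h p _ \<longleftrightarrow> False"

text \<open>\<open>P\<close> collects the values of \<open>own\<close> that are preserved: all of
  them under allocations and killing CASes, all but \<open>Some t\<close> when thread
  \<open>t\<close> publishes its cnode. \<open>None\<close> always belongs to \<open>P\<close>, as
  publication is irrevocable.\<close>

definition evolves :: "'t option set \<Rightarrow> (ref \<Rightarrow> ref) \<Rightarrow> (ref \<Rightarrow> 't option) \<Rightarrow> ('k, 'v) heap \<Rightarrow>
    (ref \<Rightarrow> ref) \<Rightarrow> (ref \<Rightarrow> 't option) \<Rightarrow> ('k, 'v) heap \<Rightarrow> bool" where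
  "evolves P g own h g' own' h' \<longleftrightarrow> None \<in> P \<and> ext h h' \<and>
     (\<forall>x\<in>dom h. g' x = g x \<and> (own x \<in> P \<longrightarrow> own' x = own x))"

section \<open>Stability of what a thread knows while the heap evolves\<close>

lemma inode_ext: "ext h h' \<Longrightarrow> inode h x \<Longrightarrow> inode h' x"
  using ext_INode by (auto simp: inode_def)

lemma snode_ext: "ext h h' \<Longrightarrow> snode h x \<Longrightarrow> snode h' x"
  using ext_SNode by (fastforce simp: snode_def)

lemma null_or_tombed_ext: "ext h h' \<Longrightarrow> null_or_tombed h w \<Longrightarrow> null_or_tombed h' w"
  by (auto simp: null_or_tombed_def ext_tombed split: option.splits)

lemma never_heavier_ext: "ext h h' \<Longrightarrow> never_heavier h xs ys \<Longrightarrow> never_heavier h' xs ys"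
  using ext_trans by (auto simp: never_heavier_def)

lemma inode_dom: "inode h x \<Longrightarrow> x \<in> dom h" by (auto simp: inode_def)

lemma visitable_dom: "visitable g own h x \<Longrightarrow> x \<in> dom h" by (auto simp: visitable_def inode_def)

lemma root_inode_evolves: "evolves P g own h g' own' h' \<Longrightarrow> root_inode g h x \<Longrightarrow> root_inode g' h' x"
  using inode_ext[of h h' x] inode_dom[of h x] by (auto simp: evolves_def root_inode_def)

lemma public_entry_evolves: 
  assumes "evolves P g own h g' own' h'" "public_entry own h x"
  shows "public_entry own' h' x"
proof -
  obtain d b xs where d: "h d = Some (CNode b xs)" "x \<in> set xs" "own d = None"
    using assms(2) by (auto simp: public_entry_def)
  then have "own' d = None" "h' d = Some (CNode b xs)"
    using assms(1) ext_CNode[of h h' d b xs] by (auto simp: evolves_def dom_def)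
  with d(2) show ?thesis by (auto simp: public_entry_def)
qed

lemma visitable_evolves: "evolves P g own h g' own' h' \<Longrightarrow> visitable g own h x \<Longrightarrow> visitable g' own' h' x"
  using public_entry_evolves[of P g own h g' own' h' x] inode_ext[of h h' x] inode_dom[of h x]
  by (auto simp: evolves_def visitable_def)

lemma chain_cong: "(\<And>x. x \<in> set (i # anc) \<Longrightarrow> g' x = g x) \<Longrightarrow> chain g' i anc = chain g i anc"
  by (induction anc arbitrary: i) auto

lemma visitable_path_evolves:
  assumes "evolves P g own h g' own' h'" "visitable_path g own h i anc"
  shows "visitable_path g' own' h' i anc"
proof -
  have "chain g' i anc = chain g i anc"
    by (rule chain_cong) (use assms visitable_dom[of g own h] in \<open>auto simp: evolves_def visitable_path_def\<close>)
  then show ?thesis using assms(2) visitable_evolves[OF assms(1)] by (simp add: visitable_path_def)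
qed

lemma public_cnode_evolves: "evolves P g own h g' own' h' \<Longrightarrow> public_cnode g own h i c \<Longrightarrow>
    public_cnode g' own' h' i c \<and> array_of h' c = array_of h c"
  by (fastforce simp: evolves_def public_cnode_def dom_def dest: ext_CNode)

lemma private_cnode_evolves: "evolves P g own h g' own' h' \<Longrightarrow> Some t \<in> P \<Longrightarrow> private_cnode g own h t i c \<Longrightarrow>
    private_cnode g' own' h' t i c \<and> array_of h' c = array_of h c"
  by (fastforce simp: evolves_def private_cnode_def dom_def dest: ext_CNode)

lemma partial_copy_evolves: "evolves P g own h g' own' h' \<Longrightarrow>
    public_cnode g own h i c \<Longrightarrow> partial_copy h c es \<Longrightarrow> partial_copy h' c es"
  using public_cnode_evolves[of P g own h g' own' h' i c] never_heavier_ext[of h h'] snode_ext[of h h']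
  by (auto simp: partial_copy_def evolves_def)

text \<open>\<open>hidden_live\<close> is a separate hypothesis because \<open>ext\<close> alone
  would let the hidden inode be emptied or appear in another cnode. The bound in
  \<open>CleanCas\<close> survives because weights only fall; \<open>Some t\<close> in
  \<open>P\<close> keeps the private cnodes of \<open>t\<close> private.\<close>

lemma ctl_inv_evolves:
  assumes "evolves P g own h g' own' h'" "Some t \<in> P"
    and "\<And>i c j. hidden_live h c j \<Longrightarrow> private_cnode g own h t i c \<Longrightarrow> hidden_live h' c j"
    and "ctl_inv g own h t opn ctl"
  shows "ctl_inv g' own' h' t opn ctl"
proof -
  have e: "ext h h'" using assms(1) by (simp add: evolves_def)
  note o = public_cnode_evolves[OF assms(1)]
    and n = private_cnode_evolves[OF assms(1,2)] and b = never_heavier_ext[OF e]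
    and k = visitable_evolves[OF assms(1)] and p = visitable_path_evolves[OF assms(1)]
  show ?thesis
  proof (cases ctl)
    case (InsertCas i c n)
    then show ?thesis using assms(4) o[of i c] n[of i] b k[of i] assms(3)
      by fastforce
  next
    case (CleanCas i c w)
    have "total_weight h' (array_of h c) \<le> total_weight h (array_of h c)" by (rule total_weight_ext[OF e])
    moreover have "visitable g' own' h' i" "public_cnode g' own' h' i c" "array_of h' c = array_of h c"
      using assms(4) CleanCas o[of i c] k[of i] by auto
    ultimately show ?thesis using assms(4) CleanCas n[of i] b null_or_tombed_ext[OF e, of w]
      by fastforce
  next
    case (TombCas i c w lev anc v)
    have "visitable_path g' own' h' i anc" "public_cnode g' own' h' i c" "array_of h' c = array_of h c"
      using assms(4) TombCas o[of i c] p[of i anc] by auto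
    then show ?thesis using assms(4) TombCas n[of i] b null_or_tombed_ext[OF e, of w]
      by fastforce
  qed (use assms(4) o n k p root_inode_evolves[OF assms(1)] partial_copy_evolves[OF assms(1)] in auto)
qed

text \<open>Evolution by allocations alone. New cnodes may hold an old inode only if it was an entry of a
  published cnode, and new inodes do not lead to light cnodes, except for roots.\<close>

definition grow :: "(ref \<Rightarrow> ref) \<Rightarrow> (ref \<Rightarrow> 't option) \<Rightarrow> ('k, 'v) heap \<Rightarrow>
    (ref \<Rightarrow> ref) \<Rightarrow> (ref \<Rightarrow> 't option) \<Rightarrow> ('k, 'v) heap \<Rightarrow> bool" where
  "grow g own h g' own' h' \<longleftrightarrow> h \<subseteq>\<^sub>m h' \<and> (\<forall>x\<in>dom h. g' x = g x \<and> own' x = own x) \<and>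
     (\<forall>d b xs x. h d = None \<and> h' d = Some (CNode b xs) \<and> x \<in> set xs \<and> inode h x \<longrightarrow> public_entry own h x) \<and>
     (\<forall>p w. h p = None \<and> h' p = Some (INode w) \<longrightarrow> g' p = p \<or>
        (\<exists>c b xs. w = Some c \<and> h' c = Some (CNode b xs) \<and> 2 \<le> total_weight h' xs))"

section \<open>Allocations\<close>

lemma map_leD: "h \<subseteq>\<^sub>m h' \<Longrightarrow> h x = Some nd \<Longrightarrow> h' x = Some nd"
  by (force simp: map_le_def)

lemma map_le_ext: "h \<subseteq>\<^sub>m h' \<Longrightarrow> ext h h'"
  by (auto simp: ext_def dest: map_leD)

lemma grow_evolves: "grow g own h g' own' h' \<Longrightarrow> evolves UNIV g own h g' own' h'"
  by (auto simp: grow_def evolves_def map_le_ext)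

lemma grow_refl: "grow g own h g own h" by (auto simp: grow_def)

text \<open>An inode is allocated after the cnode it leads to. The hypothesis for
  \<open>INode\<close> therefore expects that cnode to be labelled with the reference
  \<open>a\<close> in advance, while \<open>a\<close> is still free.\<close>

lemma heap_inv_alloc:
  assumes st: "heap_inv g own h" and al: "alloc h nd a h'"
    and nd: "case nd of SNode k v b \<Rightarrow> True
      | CNode b xs \<Rightarrow> wf_cnode b xs \<and> (\<forall>x\<in>set xs. snode h x \<or> inode h x \<and> g x = \<gamma> \<and> g x \<noteq> x)
      | INode w \<Rightarrow> \<exists>m. w = Some m \<and> public_cnode g own h a m"
  shows "heap_inv (g(a := \<gamma>)) (own(a := o')) h'"
proof -
  have a: "h a = None" "h' = h(a \<mapsto> nd)" using al by (auto simp: alloc_def)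
  then have le: "h \<subseteq>\<^sub>m h'" by (auto simp: map_le_def)
  have sn: "snode h x \<Longrightarrow> snode h' x" and iN: "inode h x \<Longrightarrow> inode h' x \<and> x \<noteq> a" for x
    using a by (auto simp: snode_def inode_def)
  show ?thesis
    unfolding heap_inv_def
  proof (intro conjI allI impI)
    fix c b xs assume c: "h' c = Some (CNode b xs)"
    show "wf_cnode b xs"
      using c a nd heap_inv_CNode(1)[OF st, of c] by (auto split: if_splits)
    show "\<forall>x\<in>set xs. snode h' x \<or> inode h' x \<and> (g(a := \<gamma>)) x = (g(a := \<gamma>)) c \<and> (g(a := \<gamma>)) x \<noteq> x"
    proof
      fix x assume x: "x \<in> set xs"
      show "snode h' x \<or> inode h' x \<and> (g(a := \<gamma>)) x = (g(a := \<gamma>)) c \<and> (g(a := \<gamma>)) x \<noteq> x"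
      proof (cases "c = a")
        case True
        then show ?thesis using c a nd x sn[of x] iN[of x] by auto
      next
        case False
        then show ?thesis using c a heap_inv_CNode(2)[OF st, of c b xs x] x sn[of x] iN[of x] by auto
      qed
    qed
  next
    fix p m assume p: "h' p = Some (INode (Some m))"
    show "(\<exists>b xs. h' m = Some (CNode b xs) \<and> (g(a := \<gamma>)) m = p \<and> (own(a := o')) m = None)
          \<or> tombed_snode h' m"
    proof (cases "p = a")
      case True
      then show ?thesis using p a nd by (auto simp: public_cnode_def)
    next
      case False
      then show ?thesis using p a heap_inv_INode[OF st, of p m] by (auto simp: tombed_snode_def)
    qed
  qed
qed

text \<open>The weight of an inode looks through one reference. \<open>heap_inv\<close> forbids
  dangling contents, so an allocation cannot change what is found there.\<close>

lemma weight_map_le: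
  assumes "heap_inv g own h" "h \<subseteq>\<^sub>m h'" "x \<in> dom h"
  shows "weight h' x = weight h x"
proof -
  have x: "h' x = h x" using assms by (auto simp: map_le_def)
  have m: "h' m = h m" if "h x = Some (INode (Some m))" for m
    using heap_inv_INode[OF assms(1) that] assms(2) by (auto simp: map_le_def tombed_snode_def dom_def)
  have t: "tomb_inode h' x = tomb_inode h x"
    unfolding tomb_inode_def tombed_snode_def x using m
    by (intro ex_cong1 conj_cong refl) simp
  show ?thesis using x t by (simp add: weight_def null_inode_def singleton_def)
qed

lemma total_weight_map_le:
  assumes "heap_inv g own h" "h \<subseteq>\<^sub>m h'" "h c = Some (CNode b xs)"
  shows "total_weight h' xs = total_weight h xs"
  by (rule total_weight_cong) (use assms weight_map_le heap_inv_entry_dom in blast)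

text \<open>\<open>h0\<close> remains the heap at the start of the atomic step while
  \<open>h\<close> runs through the intermediate heaps, so that several allocations accumulate into
  one \<open>grow\<close>.\<close>

lemma grow_alloc:
  assumes gr: "grow g0 own0 h0 g own h" and st: "heap_inv g own h" and al: "alloc h nd a h'"
    and c: "\<And>b xs x. nd = CNode b xs \<Longrightarrow> x \<in> set xs \<Longrightarrow> inode h0 x \<Longrightarrow> public_entry own0 h0 x"
    and i: "\<And>w. nd = INode w \<Longrightarrow> \<gamma> = a \<or> (\<exists>m b xs. w = Some m \<and> h m = Some (CNode b xs) \<and> 2 \<le> total_weight h xs)"
  shows "grow g0 own0 h0 (g(a := \<gamma>)) (own(a := o')) h'"
proof -
  have a: "h a = None" "h' = h(a \<mapsto> nd)" using al by (auto simp: alloc_def)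
  then have le: "h \<subseteq>\<^sub>m h'" by (auto simp: map_le_def)
  have le0: "h0 \<subseteq>\<^sub>m h" using gr by (simp add: grow_def)
  have a0: "h0 a = None" using le0 a(1) by (metis map_leD not_None_eq)
  show ?thesis
    unfolding grow_def
  proof (intro conjI allI impI)
    show "h0 \<subseteq>\<^sub>m h'" using le le0 map_le_trans by blast
    show "\<forall>x\<in>dom h0. (g(a := \<gamma>)) x = g0 x \<and> (own(a := o')) x = own0 x"
      using gr a0 by (auto simp: grow_def)
  next
    fix d b xs x
    assume "h0 d = None \<and> h' d = Some (CNode b xs) \<and> x \<in> set xs \<and> inode h0 x"
    then show "public_entry own0 h0 x" using a c gr by (auto simp: grow_def split: if_splits)
  next
    fix p w assume p: "h0 p = None \<and> h' p = Some (INode w)"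
    show "(g(a := \<gamma>)) p = p \<or>
           (\<exists>c b xs. w = Some c \<and> h' c = Some (CNode b xs) \<and> 2 \<le> total_weight h' xs)"
    proof (cases "p = a")
      case True
      then show ?thesis using p a i[of w] map_leD[OF le] total_weight_map_le[OF st le] by fastforce
    next
      case False
      then have "g p = p \<or> (\<exists>c b xs. w = Some c \<and> h c = Some (CNode b xs) \<and> 2 \<le> total_weight h xs)"
        using p a gr by (auto simp: grow_def)
      then show ?thesis using False map_leD[OF le] total_weight_map_le[OF st le] by fastforce
    qed
  qed
qed

lemma alloc_le: "alloc h nd a h' \<Longrightarrow> h \<subseteq>\<^sub>m h'"
  by (auto simp: alloc_def map_le_def)

lemma alloc_get: "alloc h nd a h' \<Longrightarrow> h' a = Some nd"
  by (auto simp: alloc_def)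

lemma weight_snode: "snode h x \<Longrightarrow> weight h x = 1"
  using weight_single[OF ext_refl, of h x] by (auto simp: snode_def singleton_SNode)

text \<open>\<open>\<gamma>\<close> anticipates the inode that the caller allocates next to hold
  \<open>c\<close>. As it is free in \<open>h'\<close>, it differs from all inodes of the forked
  path, so none of them becomes a ghost root. The bound 2 comes from the two snodes at the bottom
  and from a single live inode at every level above.\<close>

lemma fork_grow:
  fixes h h' h0 :: "('k, 'v) heap"
  assumes "fork W hc k x k' x' lev h c h'"
    and "heap_inv g own h" "grow g0 own0 h0 g own h" "snode h x" "snode h x'" "h' \<gamma> = None"
  shows "\<exists>g' own'. heap_inv g' own' h' \<and> grow g0 own0 h0 g' own' h' \<and> h \<subseteq>\<^sub>m h' \<and>
    (\<exists>b xs. h' c = Some (CNode b xs) \<and> 2 \<le> total_weight h' xs) \<and> public_cnode g' own' h' \<gamma> c"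
  using assms
proof (induction arbitrary: \<gamma> rule: fork.induct)
  case (differ lev es h c h')
  obtain b ys where cn: "cnode_of es = (CNode b ys :: ('k, 'v) node)" "ys = map snd es"
    by (simp add: cnode_of_def)
  have wf: "wf_cnode b ys"
    by (rule wf_cnode_of[OF _ cn(1)]) (use differ.hyps(1,2) in auto)
  have ys: "set ys \<subseteq> {x, x'}" using cn(2) differ.hyps(2) by (auto split: if_splits)
  note le = alloc_le[OF differ.hyps(3)]
  have sn: "snode h' x" "snode h' x'"
    using differ.prems(3,4) snode_ext[OF map_le_ext[OF le]] by auto
  have "ys = [x, x'] \<or> ys = [x', x]" using cn(2) differ.hyps(2) by auto
  then have w: "2 \<le> total_weight h' ys" using weight_snode[OF sn(1)] weight_snode[OF sn(2)] by auto
  \<comment> \<open>\<open>own\<close> is \<open>None\<close> although the cnode is not reachable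
    yet, since \<open>heap_inv\<close> demands this of the content of an inode. Only the outermost
    copy, the new value of the CAS, has an owner.\<close>
  have s: "heap_inv (g(c := \<gamma>)) (own(c := None)) h'"
    by (rule heap_inv_alloc[OF differ.prems(1) differ.hyps(3)])
      (use cn(1) wf ys differ.prems(3,4) in auto)
  have "h0 \<subseteq>\<^sub>m h" using differ.prems(2) by (simp add: grow_def)
  then have ni: "\<not> inode h0 x" "\<not> inode h0 x'"
    using differ.prems(3,4) map_leD[of h0 h] by (fastforce simp: inode_def snode_def)+
  have gw: "grow g0 own0 h0 (g(c := \<gamma>)) (own(c := None)) h'"
    by (rule grow_alloc[OF differ.prems(2,1) differ.hyps(3)]) (use cn(1) ys ni in auto)
  have o: "public_cnode (g(c := \<gamma>)) (own(c := None)) h' \<gamma> c" "h' c = Some (CNode b ys)"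
    using alloc_get[OF differ.hyps(3)] cn(1) by (auto simp: public_cnode_def)
  show ?case using s gw le w o by blast
next
  case (agree lev h c1 h1 i h2 c h')
  have i: "h1 i = None" using agree.hyps(3) by (simp add: alloc_def)
  \<comment> \<open>The induction hypothesis is taken at \<open>i\<close>, the inode allocated right
    after the deeper cnode; hence the generalisation over \<open>\<gamma>\<close>.\<close>
  obtain g1 own1 where 1: "heap_inv g1 own1 h1" "grow g0 own0 h0 g1 own1 h1" "h \<subseteq>\<^sub>m h1"
    "\<exists>b xs. h1 c1 = Some (CNode b xs) \<and> 2 \<le> total_weight h1 xs" "public_cnode g1 own1 h1 i c1"
    using agree.IH[OF agree.prems(1-4) i] by blast
  have g2: "h2 \<gamma> = None"
    using alloc_le[OF agree.hyps(4)] agree.prems(5) map_leD[of h2 h'] by (metis not_None_eq)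
  let ?g2 = "g1(i := \<gamma>)" and ?own2 = "own1(i := None)"
  have ig: "i \<noteq> \<gamma>" using g2 alloc_get[OF agree.hyps(3)] by auto
  have s2: "heap_inv ?g2 ?own2 h2"
    by (rule heap_inv_alloc[OF 1(1) agree.hyps(3)]) (use 1(5) in auto)
  have w2: "grow g0 own0 h0 ?g2 ?own2 h2"
    by (rule grow_alloc[OF 1(2,1) agree.hyps(3)]) (use 1(4) in auto)
  let ?g3 = "?g2(c := \<gamma>)" and ?own3 = "?own2(c := None)"
  obtain b ys where cn: "cnode_of [(chunk W hc lev k, i)] = (CNode b ys :: ('k, 'v) node)" "ys = [i]"
    by (simp add: cnode_of_def)
  have s3: "heap_inv ?g3 ?own3 h'"
    by (rule heap_inv_alloc[OF s2 agree.hyps(4)])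
      (use cn wf_cnode_of[OF _ cn(1)] ig alloc_get[OF agree.hyps(3)] in \<open>auto simp: inode_def\<close>)
  have i0: "h0 i = None" using i 1(2) map_leD[of h0 h1] by (metis grow_def not_None_eq)
  have w3: "grow g0 own0 h0 ?g3 ?own3 h'"
    by (rule grow_alloc[OF w2 s2 agree.hyps(4)]) (use cn i0 in \<open>auto simp: inode_def\<close>)
  note le2 = alloc_le[OF agree.hyps(3)] and le3 = alloc_le[OF agree.hyps(4)]
  obtain b1 xs1 where c1: "h' c1 = Some (CNode b1 xs1)"
    using 1(4) map_leD[OF le2] map_leD[OF le3] by blast
  moreover have "h' i = Some (INode (Some c1))"
    using map_leD[OF le3 alloc_get[OF agree.hyps(3)]] .
  ultimately have "weight h' i = 2" by (auto intro: weight_live simp: live_inode_def)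
  then have "2 \<le> total_weight h' ys" using cn(2) by simp
  moreover have "h \<subseteq>\<^sub>m h'" using 1(3) le2 le3 map_le_trans by blast
  moreover have "public_cnode ?g3 ?own3 h' \<gamma> c" "h' c = Some (CNode b ys)"
    using alloc_get[OF agree.hyps(4)] cn(1) by (auto simp: public_cnode_def)
  ultimately show ?case using s3 w3 by blast
qed

section \<open>Steps of one thread\<close>

definition light_inode :: "('k, 'v) heap \<Rightarrow> ref \<Rightarrow> bool" where
  "light_inode h p \<longleftrightarrow> (\<exists>c b xs. h p = Some (INode (Some c)) \<and> h c = Some (CNode b xs) \<and> total_weight h xs \<le> 1)"

definition root_inv :: "(ref \<Rightarrow> ref) \<Rightarrow> ('k, 'v) memory \<Rightarrow> bool" where
  "root_inv g s \<longleftrightarrow> (\<forall>r. rt s = Some r \<longrightarrow> root_inode g (heap s) r)"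

definition out_ctl_inv :: "(ref \<Rightarrow> ref) \<Rightarrow> (ref \<Rightarrow> 't option) \<Rightarrow> ('k, 'v) heap \<Rightarrow> 't \<Rightarrow>
    ('k, 'v) operation \<Rightarrow> 'v outcome \<Rightarrow> bool" where
  "out_ctl_inv g own h t opn out \<longleftrightarrow> (case out of Continue ctl \<Rightarrow> ctl_inv g own h t opn ctl | Return r \<Rightarrow> True)"

definition out_will_compress :: "('k, 'v) heap \<Rightarrow> ref \<Rightarrow> 'v outcome \<Rightarrow> bool" where
  "out_will_compress h p out \<longleftrightarrow> (case out of Continue ctl \<Rightarrow> will_compress h p ctl | Return r \<Rightarrow> False)"

lemma out_simps [simp]:
  "out_ctl_inv g own h t opn (Continue ctl) = ctl_inv g own h t opn ctl"
  "out_ctl_inv g own h t opn (Return r) = True"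
  "out_will_compress h p (Continue ctl) = will_compress h p ctl"
  "out_will_compress h p (Return r) = False"
  by (simp_all add: out_ctl_inv_def out_will_compress_def)

text \<open>Covers all steps that do not succeed in a CAS on an inode: reads, allocations, failed
  CASes and CASes on the root. Obligations have to survive at light inodes only, since a run over a
  heavier cnode may rightly end without any change.\<close>

definition grow_step :: "(ref \<Rightarrow> ref) \<Rightarrow> (ref \<Rightarrow> 't option) \<Rightarrow> 't \<Rightarrow> ('k, 'v) operation \<Rightarrow>
    ('k, 'v) memory \<Rightarrow> 'v ctl \<Rightarrow> ('k, 'v) memory \<Rightarrow> 'v outcome \<Rightarrow> bool" where
  "grow_step g own t opn s ctl s' out \<longleftrightarrow> (\<exists>g' own'.
     heap_inv g' own' (heap s') \<and> grow g own (heap s) g' own' (heap s') \<and> root_inv g' s' \<and>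
     out_ctl_inv g' own' (heap s') t opn out \<and>
     (\<forall>p. g p \<noteq> p \<and> light_inode (heap s) p \<and> will_compress (heap s) p ctl \<longrightarrow> out_will_compress (heap s') p out))"

text \<open>A successful CAS either kills \<open>i\<close>, which endangers the parent, or installs
  the writer's private cnode, which endangers \<open>i\<close> itself. In both cases the writer
  takes on the new obligation, or \<open>i\<close> was light before without the writer being
  responsible, so that by the invariant another thread is. Inserts and cleans rely on the
  latter.\<close>

definition cas_step :: "(ref \<Rightarrow> ref) \<Rightarrow> (ref \<Rightarrow> 't option) \<Rightarrow> 't \<Rightarrow> ('k, 'v) operation \<Rightarrow>
    ('k, 'v) memory \<Rightarrow> 'v ctl \<Rightarrow> ('k, 'v) memory \<Rightarrow> 'v outcome \<Rightarrow> bool" where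
  "cas_step g own t opn s ctl s' out \<longleftrightarrow> (\<exists>i c n own'.
     heap s i = Some (INode (Some c)) \<and> visitable g own (heap s) i \<and> public_cnode g own (heap s) i c \<and>
     s' = s\<lparr>heap := (heap s)(i \<mapsto> INode n)\<rparr> \<and>
     out_ctl_inv g own' (heap s') t opn out \<and>
     (\<forall>p. g p \<noteq> p \<and> p \<noteq> i \<and> will_compress (heap s) p ctl \<longrightarrow> out_will_compress (heap s') p out) \<and>
     (null_or_tombed (heap s) n \<and> own' = own \<and>
        (g (g i) \<noteq> g i \<longrightarrow> out_will_compress (heap s') (g i) out \<or>
           total_weight (heap s) (array_of (heap s) c) \<le> 1 \<and> \<not> will_compress (heap s) i ctl) \<or>
      (\<exists>c'. n = Some c' \<and> private_cnode g own (heap s) t i c' \<and> own' = own(c' := None) \<and>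
        (g i \<noteq> i \<and> total_weight (heap s) (array_of (heap s) c') \<le> 1 \<longrightarrow> out_will_compress (heap s') i out \<or>
           total_weight (heap s) (array_of (heap s) c) \<le> 1 \<and> \<not> will_compress (heap s) i ctl))))"

lemma grow_step_same:
  assumes "heap_inv g own (heap s)" "root_inv g s" "out_ctl_inv g own (heap s) t opn out"
    and "\<And>p. g p \<noteq> p \<Longrightarrow> light_inode (heap s) p \<Longrightarrow> will_compress (heap s) p ctl \<Longrightarrow> out_will_compress (heap s) p out"
  shows "grow_step g own t opn s ctl s out"
  unfolding grow_step_def using assms grow_refl[of g own "heap s"] by blast

lemma root_inv_grow:
  assumes "grow g own (heap s) g' own' h'" "root_inv g s"
  shows "root_inv g' (s\<lparr>heap := h'\<rparr>)"
  using assms(2) root_inode_evolves[OF grow_evolves[OF assms(1)]] by (auto simp: root_inv_def)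

lemma grow_stepI:
  assumes "heap_inv g' own' h'" "grow g own (heap s) g' own' h'" "root_inv g s"
    "ctl_inv g' own' h' t opn ctl'"
    and "\<And>p. g p \<noteq> p \<Longrightarrow> light_inode (heap s) p \<Longrightarrow> will_compress (heap s) p ctl \<Longrightarrow> will_compress h' p ctl'"
  shows "grow_step g own t opn s ctl (s\<lparr>heap := h'\<rparr>) (Continue ctl')"
  unfolding grow_step_def
  using assms root_inv_grow[OF assms(2,3)] by (intro exI[of _ g'] exI[of _ own']) simp

lemma snode_alloc:
  assumes "heap_inv g own h" "grow g0 own0 h0 g own h" "alloc h (SNode k v b) a h'"
  shows "heap_inv g own h'" "grow g0 own0 h0 g own h'" "h' a = Some (SNode k v b)" "h \<subseteq>\<^sub>m h'"
  \<comment> \<open>Snodes need no ghost data; reusing the old values \<open>g a\<close> and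
    \<open>own a\<close> leaves both ghost functions unchanged.\<close>
  using heap_inv_alloc[OF assms(1,3), of "g a" "own a"] grow_alloc[OF assms(2,1,3), of "g a" "own a"]
    alloc_get[OF assms(3)] alloc_le[OF assms(3)] by simp_all

lemma public_cnode_entry:
  assumes "heap_inv g own h" "public_cnode g own h i c" "x \<in> set (array_of h c)"
  shows "snode h x \<or> inode h x \<and> g x = i \<and> i \<noteq> x \<and> public_entry own h x"
proof -
  obtain b xs where c: "h c = Some (CNode b xs)" "g c = i" "own c = None"
    using assms(2) by (auto simp: public_cnode_def)
  then show ?thesis
    using heap_inv_CNode(2)[OF assms(1) c(1), of x] assms(3) by (auto simp: public_entry_def)
qed

text \<open>Entries have three sources: the published cnode \<open>c\<close>, snodes, and inodes
  allocated within the same step. Inodes of the first kind are published entries, as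
  \<open>grow\<close> requires of old inodes; those of the third kind do not exist in
  \<open>h0\<close>.\<close>

lemma copy_alloc:
  assumes st: "heap_inv g own h" and gr: "grow g0 own0 h0 g own h" and st0: "heap_inv g0 own0 h0"
    and public_cnode: "public_cnode g0 own0 h0 i c" and al: "alloc h (CNode b ys) a h'" and wf: "wf_cnode b ys"
    and ys: "\<And>x. x \<in> set ys \<Longrightarrow> x \<in> set (array_of h0 c) \<or> snode h x \<or>
      inode h x \<and> g x = i \<and> i \<noteq> x \<and> h0 x = None"
  shows "\<exists>g' own'. heap_inv g' own' h' \<and> grow g0 own0 h0 g' own' h' \<and> private_cnode g' own' h' t i a \<and>
    array_of h' a = ys"
proof -
  have le: "h0 \<subseteq>\<^sub>m h" using gr by (simp add: grow_def)
  note e = map_le_ext[OF le]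
  have gg: "g x = g0 x" if "inode h0 x" for x using gr that by (auto simp: grow_def inode_def)
  have "heap_inv (g(a := i)) (own(a := Some t)) h'"
    by (rule heap_inv_alloc[OF st al])
      (use wf ys public_cnode_entry[OF st0 public_cnode] snode_ext[OF e] inode_ext[OF e] gg in fastforce)
  moreover have "grow g0 own0 h0 (g(a := i)) (own(a := Some t)) h'"
  proof (rule grow_alloc[OF gr st al])
    fix b' xs x assume "CNode b ys = CNode b' xs" "x \<in> set xs" and i: "inode h0 x"
    then have "x \<in> set (array_of h0 c)"
      using ys[of x] inode_ext[OF e i] by (auto simp: inode_def snode_def)
    then show "public_entry own0 h0 x"
      using public_cnode_entry[OF st0 public_cnode, of x] i by (auto simp: inode_def snode_def)
  qed simp
  moreover have "private_cnode (g(a := i)) (own(a := Some t)) h' t i a" "array_of h' a = ys"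
    using alloc_get[OF al] by (auto simp: private_cnode_def)
  ultimately show ?thesis by blast
qed

lemma new_trie_grow:
  fixes h h' :: "('k, 'v) heap"
  assumes "heap_inv g own h" "new_trie W hc k v h i h'"
  shows "\<exists>g' own'. heap_inv g' own' h' \<and> grow g own h g' own' h' \<and> root_inode g' h' i"
proof -
  obtain x h1 c h2 where al: "alloc h (SNode k v False) x h1"
     "alloc h1 (cnode_of [(chunk W hc 0 k, x)]) c h2" "alloc h2 (INode (Some c)) i h'"
    using assms(2) by (auto simp: new_trie_def)
  obtain b ys where cn: "cnode_of [(chunk W hc 0 k, x)] = (CNode b ys :: ('k, 'v) node)" "ys = [x]"
    by (simp add: cnode_of_def)
  have wf: "wf_cnode b ys" by (rule wf_cnode_of[OF _ cn(1)]) simp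
  note 1 = snode_alloc[OF assms(1) grow_refl al(1)]
  have x: "snode h1 x" using 1(3) by (auto simp: snode_def)
  have hx: "h x = None" using al(1) by (simp add: alloc_def)
  \<comment> \<open>The cnode is labelled with \<open>i\<close> before \<open>i\<close> is
    allocated; \<open>i\<close> will then be labelled with itself, as a root.\<close>
  let ?g = "g(c := i)" and ?own = "own(c := None)"
  have s2: "heap_inv ?g ?own h2"
    by (rule heap_inv_alloc[OF 1(1) al(2)]) (use x wf cn in auto)
  have g2: "grow g own h ?g ?own h2"
    by (rule grow_alloc[OF 1(2,1) al(2)]) (use cn hx in \<open>auto simp: inode_def\<close>)
  have o: "public_cnode ?g ?own h2 i c" using alloc_get[OF al(2)] cn by (auto simp: public_cnode_def)
  have "heap_inv (?g(i := i)) (?own(i := None)) h'"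
    by (rule heap_inv_alloc[OF s2 al(3)]) (use o in simp)
  moreover have "grow g own h (?g(i := i)) (?own(i := None)) h'"
    by (rule grow_alloc[OF g2 s2 al(3)]) auto
  moreover have "root_inode (?g(i := i)) h' i"
    using alloc_get[OF al(3)] by (auto simp: root_inode_def inode_def)
  ultimately show ?thesis by blast
qed

lemma cas_mainD:
  assumes "cas_main i (Some c) n s = (b, s')"
  shows "b \<and> heap s i = Some (INode (Some c)) \<and> s' = s\<lparr>heap := (heap s)(i \<mapsto> INode n)\<rparr> \<or> \<not> b \<and> s' = s"
  using assms by (auto simp: cas_main_def split: if_splits)

lemma cas_ext:
  assumes "h i = Some (INode (Some c))" "public_cnode g own h i c"
  shows "ext h (h(i \<mapsto> INode n))"
  using assms by (auto simp: ext_def public_cnode_def tombed_snode_def)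

lemma cas_evolves_null:
  assumes "h i = Some (INode (Some c))" "public_cnode g own h i c"
  shows "evolves UNIV g own h g own (h(i \<mapsto> INode n))"
  using cas_ext[OF assms] by (simp add: evolves_def)

lemma cas_evolves_new:
  assumes "h i = Some (INode (Some c))" "public_cnode g own h i c" "own c' = Some t"
  shows "evolves (- {Some t}) g own h g (own(c' := None)) (h(i \<mapsto> INode n))"
  using cas_ext[OF assms(1,2)] assms(3) by (auto simp: evolves_def)

lemma visited_cnode_public:
  assumes "heap_inv g own h" "h i = Some (INode (Some c))" "h c = Some (CNode b xs)"
  shows "public_cnode g own h i c"
  using heap_inv_INode[OF assms(1,2)] assms(3) by (auto simp: public_cnode_def tombed_snode_def)

lemma visitable_path_child:
  assumes "heap_inv g own h" "visitable_path g own h i anc" "public_cnode g own h i c"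
    "x \<in> set (array_of h c)" "inode h x"
  shows "visitable_path g own h x (i # anc)"
  using public_cnode_entry[OF assms(1,3,4)] assms(2,5)
  by (auto simp: visitable_path_def visitable_def inode_def snode_def)

section \<open>Weight comparisons between a cnode and its copies\<close>

lemma never_heavier_refl: "never_heavier h xs xs" by (simp add: never_heavier_def)

text \<open>The old and the new entry both weigh exactly 1 in every later heap.\<close>

lemma never_heavier_update:
  assumes "singleton h (xs ! p)" "singleton h y" "p < length xs"
  shows "never_heavier h xs (xs[p := y])"
  unfolding never_heavier_def
proof (intro allI impI)
  fix h' assume "ext h h'"
  then show "total_weight h' xs \<le> total_weight h' (xs[p := y])"
    using total_weight_update[OF assms(3), of h' y] weight_single[of h h'] assms(1,2) by simp
qed

lemma never_heavier_insert: "never_heavier h xs (take p xs @ y # drop p xs)"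
  unfolding never_heavier_def
proof (intro allI impI)
  fix h'
  show "total_weight h' xs \<le> total_weight h' (take p xs @ y # drop p xs)"
    using total_weight_simps(3)[of h' "take p xs" "drop p xs"] by simp
qed

lemma partial_copy_start:
  assumes "heap_inv g own h" "h c = Some (CNode b xs)"
  shows "partial_copy h c (entries b xs)"
  using entries_wf[OF heap_inv_CNode(1)[OF assms]] assms(2) 
  by (auto simp: partial_copy_def never_heavier_refl) (metis image_eqI set_map snd_conv)

text \<open>The dropped entry remains a null-inode, so it contributes 0 to the comparison in every
  later heap.\<close>

lemma partial_copy_filter:
  assumes "partial_copy h c (ds @ e # es)" "null_inode h (snd e)"
  shows "partial_copy h c (ds @ es)"
proof -
  have "never_heavier h (array_of h c) (map snd (ds @ es))"
    unfolding never_heavier_def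
  proof (intro allI impI)
    fix h' assume e: "ext h h'"
    then have "total_weight h' (array_of h c) \<le> total_weight h' (map snd (ds @ e # es))"
      using assms(1) unfolding partial_copy_def never_heavier_def by blast
    then show "total_weight h' (array_of h c) \<le> total_weight h' (map snd (ds @ es))"
      using weight_null[OF e assms(2)] by simp
  qed
  then show ?thesis using assms(1) by (auto simp: partial_copy_def)
qed

lemma partial_copy_replace:
  assumes "partial_copy h c (ds @ (j, x) # es)" "singleton h x" "snode h y"
  shows "partial_copy h c ((ds @ [(j, y)]) @ es)"
proof -
  have y: "singleton h y" using assms(3) by (auto simp: singleton_def snode_def)
  have "never_heavier h (array_of h c) (map snd ((ds @ [(j, y)]) @ es))"
    unfolding never_heavier_def
  proof (intro allI impI)
    fix h' assume e: "ext h h'"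
    then have "total_weight h' (array_of h c) \<le> total_weight h' (map snd (ds @ (j, x) # es))"
      using assms(1) unfolding partial_copy_def never_heavier_def by blast
    then show "total_weight h' (array_of h c) \<le> total_weight h' (map snd ((ds @ [(j, y)]) @ es))"
      using weight_single[OF e assms(2)] weight_single[OF e y] by simp
  qed
  then show ?thesis using assms(1,3) by (auto simp: partial_copy_def)
qed

lemma partial_copy_cnode:
  assumes "partial_copy h c ds" "cnode_of ds = CNode b ys"
  shows "wf_cnode b ys" "ys = map snd ds" "never_heavier h (array_of h c) ys"
    "x \<in> set ys \<Longrightarrow> x \<in> set (array_of h c) \<or> snode h x"
  using assms wf_cnode_of[OF _ assms(2)] by (auto simp: partial_copy_def cnode_of_def)

lemma partial_copy_total_weight:
  "partial_copy h c ds \<Longrightarrow> total_weight h (array_of h c) \<le> total_weight h (map snd ds)"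
  by (simp add: partial_copy_def never_heavier_def)

text \<open>The outermost invocation returns without running tombCompress, but its inode is a ghost
  root by \<open>chain\<close>, so no obligation gets lost. For every other ancestor the thread
  continues with a \<open>TombCompress\<close> that covers it.\<close>

lemma to_caller_ok:
  assumes "is_remove opn" "visitable_path g own h i anc"
  shows "out_ctl_inv g own h t opn (to_caller W v lev anc)"
    "p \<in> set anc \<Longrightarrow> g p \<noteq> p \<Longrightarrow> out_will_compress h p (to_caller W v lev anc)"
  using assms by (cases anc; auto simp: after_removal_def visitable_path_def split: if_splits)+

lemma after_removal_ok:
  assumes "is_remove opn" "visitable_path g own h i anc"
  shows "out_ctl_inv g own h t opn (after_removal v i lev anc)"
    "p \<in> set (i # anc) \<Longrightarrow> g p \<noteq> p \<Longrightarrow> out_will_compress h p (after_removal v i lev anc)"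
  using assms by (cases anc; auto simp: after_removal_def visitable_path_def split: if_splits)+

lemma chain_parent: "chain g i anc \<Longrightarrow> g (g i) \<noteq> g i \<Longrightarrow> g i \<in> set anc"
  by (cases anc) auto

section \<open>Compare-and-swap steps\<close>

lemma cas_root_grow:
  assumes "heap_inv g own (heap s)" "root_inv g s" "ctl_inv g own (heap s) t opn (CasRoot e n)"
    "cas_root e n s = (b, s')" "out = Continue Start \<or> (\<exists>r. out = Return r)"
  shows "grow_step g own t opn s (CasRoot e n) s' out"
  unfolding grow_step_def
  using assms grow_refl[of g own "heap s"]
  by (intro exI[of _ g] exI[of _ own])
    (auto simp: cas_root_def root_inv_def split: if_splits)

text \<open>An insert ends without obligations, so \<open>i\<close> may be light afterwards only if
  it was light before. Under \<open>never_heavier\<close> a light copy implies a light original; a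
  copy with a hidden live inode weighs at least 2 and is not light at all.\<close>

lemma insert_cas_step:
  assumes st: "heap_inv g own (heap s)" and r: "root_inv g s"
    and ctl_inv: "ctl_inv g own (heap s) t opn (InsertCas i c n)"
    and cas: "cas_main i (Some c) n s = (b, s')"
    and out: "out = (if b then Return Inserted else Continue Start)"
  shows "grow_step g own t opn s (InsertCas i c n) s' out \<or>
    cas_step g own t opn s (InsertCas i c n) s' out"
proof (cases b)
  case False
  then show ?thesis using cas_mainD[OF cas] out st r by (auto intro!: grow_step_same)
next
  case True
  obtain c' where c': "n = Some c'" "private_cnode g own (heap s) t i c'"
    "never_heavier (heap s) (array_of (heap s) c) (array_of (heap s) c') \<or> (\<exists>j. hidden_live (heap s) c' j)"
    using ctl_inv by auto
  have "total_weight (heap s) (array_of (heap s) c) \<le> 1" if w: "total_weight (heap s) (array_of (heap s) c') \<le> 1"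
    using c'(3)
  proof
    assume "never_heavier (heap s) (array_of (heap s) c) (array_of (heap s) c')"
    then show ?thesis using w ext_refl[of "heap s"] unfolding never_heavier_def by (meson le_trans)
  next
    assume "\<exists>j. hidden_live (heap s) c' j"
    then obtain j where "j \<in> set (array_of (heap s) c')" "weight (heap s) j = 2" by (auto simp: hidden_live_def)
    then show ?thesis using weight_le_total_weight[of j "array_of (heap s) c'" "heap s"] w by simp
  qed
  then have "cas_step g own t opn s (InsertCas i c n) s' out"
    unfolding cas_step_def using cas_mainD[OF cas] out True ctl_inv c'(1,2)
    by (intro exI[of _ i] exI[of _ c] exI[of _ n] exI[of _ "own(c' := None)"]) auto
  then show ?thesis ..
qed

text \<open>A clean restarts its operation without obligations. It kills only if the array weighs at
  most 1, and if it installs a light copy then \<open>c\<close> was light; either way another thread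
  already answers for \<open>i\<close>.\<close>

lemma clean_cas_step:
  assumes st: "heap_inv g own (heap s)" and r: "root_inv g s"
    and ctl_inv: "ctl_inv g own (heap s) t opn (CleanCas i c n)"
    and cas: "cas_main i (Some c) n s = (b, s')"
  shows "grow_step g own t opn s (CleanCas i c n) s' (Continue Start) \<or>
    cas_step g own t opn s (CleanCas i c n) s' (Continue Start)"
proof (cases b)
  case False
  then show ?thesis using cas_mainD[OF cas] st r by (auto intro!: grow_step_same)
next
  case True
  then have d: "heap s i = Some (INode (Some c))" "s' = s\<lparr>heap := (heap s)(i \<mapsto> INode n)\<rparr>"
    using cas_mainD[OF cas] by auto
  consider "null_or_tombed (heap s) n" "total_weight (heap s) (array_of (heap s) c) \<le> 1"
    | c' where "n = Some c'" "private_cnode g own (heap s) t i c'"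
       "never_heavier (heap s) (array_of (heap s) c) (array_of (heap s) c')"
    using ctl_inv by auto
  then have "cas_step g own t opn s (CleanCas i c n) s' (Continue Start)"
  proof cases
    case 1
    then show ?thesis unfolding cas_step_def using d ctl_inv
      by (intro exI[of _ i] exI[of _ c] exI[of _ n] exI[of _ own]) auto
  next
    case 2
    then have "total_weight (heap s) (array_of (heap s) c) \<le> total_weight (heap s) (array_of (heap s) c')"
      by (simp add: never_heavier_def)
    with 2 show ?thesis unfolding cas_step_def using d ctl_inv
      by (intro exI[of _ i] exI[of _ c] exI[of _ n] exI[of _ "own(c' := None)"]) auto
  qed
  then show ?thesis ..
qed

text \<open>No weights are compared, because this thread is itself about to run tombCompress on
  \<open>i\<close> unless \<open>i\<close> is a root. If it has killed \<open>i\<close>, the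
  non-root parent lies on its stack.\<close>

lemma remove_cas_step:
  assumes st: "heap_inv g own (heap s)" and r: "root_inv g s"
    and ctl_inv: "ctl_inv g own (heap s) t opn (RemoveCas i c n lev anc u)"
    and cas: "cas_main i (Some c) n s = (b, s')"
    and out: "out = (if b then after_removal u i lev anc else Continue Start)"
  shows "grow_step g own t opn s (RemoveCas i c n lev anc u) s' out \<or>
    cas_step g own t opn s (RemoveCas i c n lev anc u) s' out"
proof (cases b)
  case False
  then show ?thesis using cas_mainD[OF cas] out st r by (auto intro!: grow_step_same)
next
  case True
  then have d: "heap s i = Some (INode (Some c))" "s' = s\<lparr>heap := (heap s)(i \<mapsto> INode n)\<rparr>"
    and o: "out = after_removal u i lev anc"
    using cas_mainD[OF cas] out by auto
  have t: "is_remove opn" "visitable_path g own (heap s) i anc" "public_cnode g own (heap s) i c"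
    using ctl_inv by auto
  have k: "visitable g own (heap s) i" using t(2) by (simp add: visitable_path_def)
  have "cas_step g own t opn s (RemoveCas i c n lev anc u) s' out"
  proof (cases n)
    case None
    have p: "visitable_path g own (heap s') i anc"
      using visitable_path_evolves[OF cas_evolves_null[OF d(1) t(3)] t(2)] d(2) by simp
    have "out_will_compress (heap s') (g i) out" if "g (g i) \<noteq> g i"
      using chain_parent[OF _ that] after_removal_ok(2)[OF t(1) p, of "g i"] that p o
      by (auto simp: visitable_path_def)
    then show ?thesis unfolding cas_step_def using d t k None o after_removal_ok(1)[OF t(1) p]
      by (intro exI[of _ i] exI[of _ c] exI[of _ n] exI[of _ own]) (auto simp: null_or_tombed_def)
  next
    case (Some c')
    then have c': "private_cnode g own (heap s) t i c'" using ctl_inv by auto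
    then have "own c' = Some t" by (simp add: private_cnode_def)
    then have p: "visitable_path g (own(c' := None)) (heap s') i anc"
      using visitable_path_evolves[OF cas_evolves_new[OF d(1) t(3)] t(2)] d(2) by simp
    have "out_will_compress (heap s') i out" if "g i \<noteq> i"
      using after_removal_ok(2)[OF t(1) p, of i] that o by auto
    then show ?thesis unfolding cas_step_def using d t k Some c' o after_removal_ok(1)[OF t(1) p]
      by (intro exI[of _ i] exI[of _ c] exI[of _ n] exI[of _ "own(c' := None)"]) auto
  qed
  then show ?thesis ..
qed

text \<open>Contracting an entry may leave \<open>p\<close> light, but \<open>to_caller\<close>
  makes this very thread run tombCompress on \<open>p\<close>, unless \<open>p\<close> is a
  root.\<close>

lemma contract_cas_step:
  assumes st: "heap_inv g own (heap s)" and r: "root_inv g s"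
    and ctl_inv: "ctl_inv g own (heap s) t opn (ContractCas i c c' lev (p # anc) v)"
    and cas: "cas_main p (Some c) (Some c') s = (b, s')"
    and out: "out = (if b then to_caller W v lev (p # anc) else Continue (Contract i lev (p # anc) v))"
  shows "grow_step g own t opn s (ContractCas i c c' lev (p # anc) v) s' out \<or>
    cas_step g own t opn s (ContractCas i c c' lev (p # anc) v) s' out"
proof (cases b)
  case False
  then show ?thesis using cas_mainD[OF cas] out st r ctl_inv by (auto intro!: grow_step_same)
next
  case True
  then have d: "heap s p = Some (INode (Some c))"
     "s' = s\<lparr>heap := (heap s)(p \<mapsto> INode (Some c'))\<rparr>"
    and o: "out = to_caller W v lev (p # anc)"
    using cas_mainD[OF cas] out by auto
  have t: "is_remove opn" "visitable_path g own (heap s) i (p # anc)" "public_cnode g own (heap s) p c"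
    "private_cnode g own (heap s) t p c'" using ctl_inv by auto
  have k: "visitable g own (heap s) p" using t(2) by (simp add: visitable_path_def)
  have "own c' = Some t" using t(4) by (simp add: private_cnode_def)
  then have p: "visitable_path g (own(c' := None)) (heap s') i (p # anc)"
    using visitable_path_evolves[OF cas_evolves_new[OF d(1) t(3)] t(2)] d(2) by simp
  have "out_will_compress (heap s') q out" if "g q \<noteq> q" "q \<in> set (p # anc)" for q
    using to_caller_ok(2)[OF t(1) p that(2,1)] o by auto
  then have "cas_step g own t opn s (ContractCas i c c' lev (p # anc) v) s' out"
    unfolding cas_step_def using d t k o to_caller_ok(1)[OF t(1) p, where t = t]
    by (intro exI[of _ p] exI[of _ c] exI[of _ "Some c'"] exI[of _ "own(c' := None)"])
       (auto simp del: to_caller.simps)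
  then show ?thesis ..
qed

text \<open>After a kill the thread stays responsible for its ancestors, which include a non-root
  parent. If it installs a cnode that is light, then \<open>c\<close> was light; and
  \<open>will_compress\<close> did not count this run for \<open>i\<close>, as it admits only null
  or a tombed snode while \<open>c\<close> is current.\<close>

lemma tomb_cas_step:
  assumes st: "heap_inv g own (heap s)" and r: "root_inv g s"
    and ctl_inv: "ctl_inv g own (heap s) t opn (TombCas i c w lev anc v)"
    and cas: "cas_main i (Some c) w s = (True, s')"
    and out: "out = (if null_or_tombed (heap s) w then Continue (Contract i lev anc v)
      else to_caller W v lev anc)"
  shows "cas_step g own t opn s (TombCas i c w lev anc v) s' out"
proof -
  have d: "heap s i = Some (INode (Some c))" "s' = s\<lparr>heap := (heap s)(i \<mapsto> INode w)\<rparr>"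
    using cas_mainD[OF cas] out by auto
  have t: "is_remove opn" "visitable_path g own (heap s) i anc" "public_cnode g own (heap s) i c"
    using ctl_inv by auto
  have k: "visitable g own (heap s) i" using t(2) by (simp add: visitable_path_def)
  show ?thesis
  proof (cases "null_or_tombed (heap s) w")
    case True
    then have o: "out = Continue (Contract i lev anc v)" using out by simp
    have p: "visitable_path g own (heap s') i anc"
      using visitable_path_evolves[OF cas_evolves_null[OF d(1) t(3)] t(2)] d(2) by simp
    have "g i \<in> set anc" if "g (g i) \<noteq> g i"
      using chain_parent[OF _ that] p by (auto simp: visitable_path_def)
    then show ?thesis unfolding cas_step_def using d t k p o True
      by (intro exI[of _ i] exI[of _ c] exI[of _ w] exI[of _ own]) auto
  next
    case False
    then obtain c' where c': "w = Some c'" "private_cnode g own (heap s) t i c'"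
       "never_heavier (heap s) (array_of (heap s) c) (array_of (heap s) c')"
      using ctl_inv by auto
    then have own: "own c' = Some t" by (simp add: private_cnode_def)
    have le: "total_weight (heap s) (array_of (heap s) c) \<le> total_weight (heap s) (array_of (heap s) c')"
      using c'(3) by (simp add: never_heavier_def)
    have o: "out = to_caller W v lev anc" using False out by simp
    have p: "visitable_path g (own(c' := None)) (heap s') i anc"
      using visitable_path_evolves[OF cas_evolves_new[OF d(1) t(3) own] t(2)] d(2) by simp
    \<comment> \<open>The case that \<open>q\<close> is \<open>i\<close> is not excluded: should
      \<open>i\<close> occur in \<open>anc\<close>, the thread remains responsible for it.\<close>
    have "out_will_compress (heap s') q out" if "g q \<noteq> q" "q \<in> set anc" for q
      using to_caller_ok(2)[OF t(1) p that(2,1)] o by auto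
    then show ?thesis
      unfolding cas_step_def using d t k o c'(1,2) le False to_caller_ok(1)[OF t(1) p, where t = t]
      by (intro exI[of _ i] exI[of _ c] exI[of _ w] exI[of _ "own(c' := None)"])
        (auto simp del: to_caller.simps)
  qed
qed

section \<open>Steps that build the new value of a CAS\<close>

lemma grow_visit_evolves:
  assumes "grow g own h g' own' h'"
  shows "visitable g own h i \<Longrightarrow> visitable g' own' h' i"
    "visitable_path g own h i anc \<Longrightarrow> visitable_path g' own' h' i anc"
    "public_cnode g own h i c \<Longrightarrow> public_cnode g' own' h' i c"
    "public_cnode g own h i c \<Longrightarrow> array_of h' c = array_of h c"
    "public_cnode g own h i c \<Longrightarrow> partial_copy h c es \<Longrightarrow> partial_copy h' c es"
  using visitable_evolves[OF grow_evolves[OF assms]] visitable_path_evolves[OF grow_evolves[OF assms]]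
    public_cnode_evolves[OF grow_evolves[OF assms]] partial_copy_evolves[OF grow_evolves[OF assms]] by blast+

lemma grow_le: "grow g own h g' own' h' \<Longrightarrow> h \<subseteq>\<^sub>m h'"
  by (simp add: grow_def)

lemma insert_new_step:
  assumes st: "heap_inv g own (heap s)" and r: "root_inv g s"
    and ctl_inv: "ctl_inv g own (heap s) t opn (Visit i lev anc)"
    and i: "heap s i = Some (INode (Some c))" "heap s c = Some (CNode b xs)"
      "entry m b xs = None"
    and al: "alloc (heap s) (SNode k v False) y h1" "alloc h1 (inserted m y b xs) c' h2"
  shows "grow_step g own t opn s (Visit i lev anc) (s\<lparr>heap := h2\<rparr>) (Continue (InsertCas i c (Some c')))"
proof -
  note o = visited_cnode_public[OF st i(1,2)]
  note 1 = snode_alloc[OF st grow_refl al(1)]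
  define ys where ys: "ys = take (pos b m) xs @ y # drop (pos b m) xs"
  have "\<exists>g' own'. heap_inv g' own' h2 \<and> grow g own (heap s) g' own' h2 \<and>
      private_cnode g' own' h2 t i c' \<and> array_of h2 c' = ys"
  proof (rule copy_alloc[OF 1(1,2) st o al(2)[unfolded inserted_def, folded ys]
        wf_inserted[OF heap_inv_CNode(1)[OF st i(2)] i(3) inserted_def[of m y b xs], folded ys]])
    fix x assume "x \<in> set ys"
    then have "x \<in> set xs \<or> x = y" unfolding ys by (auto dest: in_set_takeD in_set_dropD)
    then show "x \<in> set (array_of (heap s) c) \<or> snode h1 x \<or>
        inode h1 x \<and> g x = i \<and> i \<noteq> x \<and> heap s x = None"
      using 1(3) i(2) by (auto simp: snode_def)
  qed
  then obtain g' own' where g: "heap_inv g' own' h2" "grow g own (heap s) g' own' h2"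
    "private_cnode g' own' h2 t i c'" "array_of h2 c' = ys" by blast
  have "visitable g own (heap s) i" using ctl_inv by (auto simp: visitable_path_def)
  then show ?thesis
    using g grow_visit_evolves[OF g(2)] o i never_heavier_insert[of h2 xs "pos b m" y] ys
    by (intro grow_stepI[OF g(1,2) r]) auto
qed

lemma insert_same_key_step:
  assumes st: "heap_inv g own (heap s)" and r: "root_inv g s"
    and ctl_inv: "ctl_inv g own (heap s) t opn (Visit i lev anc)"
    and i: "heap s i = Some (INode (Some c))" "heap s c = Some (CNode b xs)"
      "entry m b xs = Some x" "heap s x = Some (SNode k u f)"
    and al: "alloc (heap s) (SNode k v False) y h1" "alloc h1 (replaced m y b xs) c' h2"
  shows "grow_step g own t opn s (Visit i lev anc) (s\<lparr>heap := h2\<rparr>) (Continue (InsertCas i c (Some c')))"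
proof -
  note o = visited_cnode_public[OF st i(1,2)]
  note 1 = snode_alloc[OF st grow_refl al(1)]
  note wf = heap_inv_CNode(1)[OF st i(2)]
  note e = entry_SomeD[OF wf i(3)]
  let ?ys = "xs[pos b m := y]"
  have "\<exists>g' own'. heap_inv g' own' h2 \<and> grow g own (heap s) g' own' h2 \<and>
      private_cnode g' own' h2 t i c' \<and> array_of h2 c' = ?ys"
  proof (rule copy_alloc[OF 1(1,2) st o al(2)[unfolded replaced_def]])
    show "wf_cnode b ?ys" using wf by (simp add: wf_cnode_def)
    fix x assume "x \<in> set ?ys"
    then have "x \<in> set xs \<or> x = y" using set_update_subset_insert by fast
    then show "x \<in> set (array_of (heap s) c) \<or> snode h1 x \<or>
        inode h1 x \<and> g x = i \<and> i \<noteq> x \<and> heap s x = None"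
      using 1(3) i(2) by (auto simp: snode_def)
  qed
  then obtain g' own' where g: "heap_inv g' own' h2" "grow g own (heap s) g' own' h2"
    "private_cnode g' own' h2 t i c'" "array_of h2 c' = ?ys" by blast
  have "h2 y = Some (SNode k v False)" "h2 x = Some (SNode k u f)"
    using map_leD[OF alloc_le[OF al(2)] 1(3)] map_leD[OF grow_le[OF g(2)] i(4)] by auto
  then have "never_heavier h2 xs ?ys"
    using e(2,3) by (intro never_heavier_update) (auto intro: singleton_SNode)
  moreover have "visitable g own (heap s) i" using ctl_inv by (auto simp: visitable_path_def)
  ultimately show ?thesis
    using g grow_visit_evolves[OF g(2)] o i 
    by (intro grow_stepI[OF g(1,2) r]) auto
qed

text \<open>The old entry weighs 1 and the new inode \<open>j\<close> weighs 2, yet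
  \<open>never_heavier\<close> is out of reach: it speaks of all extensions of the heap, including
  those in which \<open>j\<close> is emptied. \<open>hidden_live\<close> records instead that no
  other cnode contains \<open>j\<close>.\<close>

lemma insert_other_key_step:
  assumes st: "heap_inv g own (heap s)" and r: "root_inv g s"
    and ctl_inv: "ctl_inv g own (heap s) t opn (Visit i lev anc)"
    and i: "heap s i = Some (INode (Some c))" "heap s c = Some (CNode b xs)"
      "entry m b xs = Some x" "heap s x = Some (SNode k' u f)"
    and al: "alloc (heap s) (SNode k v False) y h1"
    and fk: "fork W hc k' x k y lev' h1 d h2"
    and al3: "alloc h2 (INode (Some d)) j h3"
    and al4: "alloc h3 (replaced m j b xs) c' h4"
  shows "grow_step g own t opn s (Visit i lev anc) (s\<lparr>heap := h4\<rparr>) (Continue (InsertCas i c (Some c')))"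
proof -
  note o = visited_cnode_public[OF st i(1,2)]
  note 1 = snode_alloc[OF st grow_refl al]
  note wf = heap_inv_CNode(1)[OF st i(2)]
  note e = entry_SomeD[OF wf i(3)]
  let ?ys = "xs[pos b m := j]"
  have sn: "snode h1 x" "snode h1 y"
    using 1(3) map_leD[OF 1(4) i(4)] by (auto simp: snode_def)
  have j2: "h2 j = None" using al3 by (simp add: alloc_def)
  obtain g2 own2 where 2: "heap_inv g2 own2 h2" "grow g own (heap s) g2 own2 h2" "h1 \<subseteq>\<^sub>m h2"
     "\<exists>b xs. h2 d = Some (CNode b xs) \<and> 2 \<le> total_weight h2 xs" "public_cnode g2 own2 h2 j d"
    using fork_grow[OF fk 1(1,2) sn j2] by blast
  let ?g = "g2(j := i)" and ?own = "own2(j := None)"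
  have s3: "heap_inv ?g ?own h3" by (rule heap_inv_alloc[OF 2(1) al3]) (use 2(5) in auto)
  have g3: "grow g own (heap s) ?g ?own h3"
    by (rule grow_alloc[OF 2(2,1) al3]) (use 2(4) in auto)
  have j0: "heap s j = None" using j2 map_leD[OF grow_le[OF 2(2)], of j]
    by (metis not_None_eq)
  have ij: "i \<noteq> j" using i(1) j0 by auto
  have j3: "inode h3 j" using alloc_get[OF al3] by (simp add: inode_def)
  have "\<exists>g' own'. heap_inv g' own' h4 \<and> grow g own (heap s) g' own' h4 \<and>
      private_cnode g' own' h4 t i c' \<and> array_of h4 c' = ?ys"
  proof (rule copy_alloc[OF s3 g3 st o al4[unfolded replaced_def]])
    show "wf_cnode b ?ys" using wf by (simp add: wf_cnode_def)
    fix x assume "x \<in> set ?ys"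
    then have "x \<in> set xs \<or> x = j" using set_update_subset_insert by fast
    then show "x \<in> set (array_of (heap s) c) \<or> snode h3 x \<or>
        inode h3 x \<and> ?g x = i \<and> i \<noteq> x \<and> heap s x = None"
      using i(2) j3 ij j0 by auto
  qed
  then obtain g' own' where g: "heap_inv g' own' h4" "grow g own (heap s) g' own' h4"
    "private_cnode g' own' h4 t i c'" "array_of h4 c' = ?ys" by blast
  note le3 = alloc_le[OF al3] and le4 = alloc_le[OF al4]
  have "h4 j = Some (INode (Some d))" using map_leD[OF le4 alloc_get[OF al3]] .
  moreover obtain b1 xs1 where "h4 d = Some (CNode b1 xs1)"
    using 2(4) map_leD[OF le3] map_leD[OF le4] by blast
  ultimately have "weight h4 j = 2" by (auto intro!: weight_live simp: live_inode_def)
  \<comment> \<open>A cnode containing \<open>j\<close> must be younger than \<open>j\<close>, since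
    entries are allocated before the cnodes that hold them; \<open>c'\<close> is the only such
    cnode.\<close>
  moreover have "q = c'" if q: "h4 q = Some (CNode bq xq)" "j \<in> set xq" for q bq xq
  proof (rule ccontr)
    assume "q \<noteq> c'"
    then have q3: "h3 q = Some (CNode bq xq)" using al4 q(1) by (auto simp: alloc_def)
    then have "h2 q = Some (CNode bq xq)" using al3 by (auto simp: alloc_def split: if_splits)
    then show False using heap_inv_entry_dom[OF 2(1) _ q(2)] j2 by auto
  qed
  moreover have "j \<in> set ?ys" using e(2) by (simp add: set_update_memI)
  ultimately have "hidden_live h4 c' j" using g(4) by (auto simp: hidden_live_def)
  moreover have "visitable g own (heap s) i" using ctl_inv by (auto simp: visitable_path_def)
  ultimately show ?thesis
    using g grow_visit_evolves[OF g(2)] o i 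
    by (intro grow_stepI[OF g(1,2) r]) auto
qed

lemma removed_alloc:
  assumes st: "heap_inv g own h" and o: "public_cnode g own h i c" and c: "h c = Some (CNode b xs)"
    and en: "entry m b xs = Some x" and al: "alloc h (removed m b xs) c' h'"
  shows "\<exists>g' own'. heap_inv g' own' h' \<and> grow g own h g' own' h' \<and> private_cnode g' own' h' t i c'"
proof -
  define ys where ys: "ys = take (pos b m) xs @ drop (Suc (pos b m)) xs"
  have "\<exists>g' own'. heap_inv g' own' h' \<and> grow g own h g' own' h' \<and>
      private_cnode g' own' h' t i c' \<and> array_of h' c' = ys"
  proof (rule copy_alloc[OF st grow_refl st o al[unfolded removed_def, folded ys]
        wf_removed[OF heap_inv_CNode(1)[OF st c] en removed_def, folded ys]])
    fix x assume "x \<in> set ys"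
    then have "x \<in> set xs" unfolding ys by (auto dest: in_set_takeD in_set_dropD)
    then show "x \<in> set (array_of h c) \<or> snode h x \<or> inode h x \<and> g x = i \<and> i \<noteq> x \<and> h x = None"
      using c by simp
  qed
  then show ?thesis by blast
qed

lemma contract_tombed_step:
  assumes st: "heap_inv g own (heap s)" and r: "root_inv g s"
    and ctl_inv: "ctl_inv g own (heap s) t opn (ContractParent i m' lev (p # anc) v)"
    and i: "heap s p = Some (INode (Some c))" "heap s c = Some (CNode b xs)"
      "entry m b xs = Some i"
    and al: "alloc (heap s) (SNode k u False) y h1" "alloc h1 (replaced m y b xs) c' h2"
  shows "grow_step g own t opn s (ContractParent i m' lev (p # anc) v) (s\<lparr>heap := h2\<rparr>)
    (Continue (ContractCas i c c' lev (p # anc) v))"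
proof -
  note o = visited_cnode_public[OF st i(1,2)]
  note 1 = snode_alloc[OF st grow_refl al(1)]
  note wf = heap_inv_CNode(1)[OF st i(2)]
  let ?ys = "xs[pos b m := y]"
  have "\<exists>g' own'. heap_inv g' own' h2 \<and> grow g own (heap s) g' own' h2 \<and>
      private_cnode g' own' h2 t p c' \<and> array_of h2 c' = ?ys"
  proof (rule copy_alloc[OF 1(1,2) st o al(2)[unfolded replaced_def]])
    show "wf_cnode b ?ys" using wf by (simp add: wf_cnode_def)
    fix x assume "x \<in> set ?ys"
    then have "x \<in> set xs \<or> x = y" using set_update_subset_insert by fast
    then show "x \<in> set (array_of (heap s) c) \<or> snode h1 x \<or>
        inode h1 x \<and> g x = p \<and> p \<noteq> x \<and> heap s x = None"
      using 1(3) i(2) by (auto simp: snode_def)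
  qed
  then obtain g' own' where g: "heap_inv g' own' h2" "grow g own (heap s) g' own' h2"
    "private_cnode g' own' h2 t p c'" by blast
  then show ?thesis
    using g grow_visit_evolves[OF g(2)] o ctl_inv
    by (intro grow_stepI[OF g(1,2) r]) auto
qed

lemma partial_copy_alloc:
  assumes st: "heap_inv g own h" and o: "public_cnode g own h i c" and cp: "partial_copy h c ds"
    and al: "alloc h (cnode_of ds) c' h'"
  shows "\<exists>g' own'. heap_inv g' own' h' \<and> grow g own h g' own' h' \<and> private_cnode g' own' h' t i c' \<and>
    never_heavier h' (array_of h' c) (array_of h' c')"
proof -
  note cn = partial_copy_cnode[OF cp cnode_of_def]
  obtain g' own' where g: "heap_inv g' own' h'" "grow g own h g' own' h'" "private_cnode g' own' h' t i c'"
    "array_of h' c' = map snd ds"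
    using copy_alloc[OF st grow_refl st o al[unfolded cnode_of_def] cn(1)] cn(4) by blast
  have "never_heavier h' (array_of h c) (map snd ds)"
    by (rule never_heavier_ext[OF map_le_ext[OF grow_le[OF g(2)]] cn(3)])
  then show ?thesis using g grow_visit_evolves(4)[OF g(2) o] by auto
qed

lemma in_partial_copy_entry:
  assumes "partial_copy h c [(j, x)]" "\<not> singleton h x"
  shows "x \<in> set (array_of h c)"
  using assms by (auto simp: partial_copy_def singleton_def snode_def)

lemma light_inode_total_weight:
  assumes "light_inode h p" "h p = Some (INode (Some c))"
  shows "total_weight h (array_of h c) \<le> 1"
  using assms by (auto simp: light_inode_def)

section \<open>Case analysis over all atomic steps\<close>

lemma step_cases:
  assumes "step W hc opn s ctl s' out"
    and "heap_inv g own (heap s)" "root_inv g s" "ctl_inv g own (heap s) t opn ctl"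
  shows "grow_step g own t opn s ctl s' out \<or> cas_step g own t opn s ctl s' out"
  using assms
proof (induction rule: step.induct)
  case (start_nonnull s r)
  then show ?case by (auto intro!: grow_step_same simp: root_inv_def)
next
  case (start_null_insert s k v i h)
  obtain g' own' where g: "heap_inv g' own' h" "grow g own (heap s) g' own' h" "root_inode g' h i"
    using new_trie_grow[OF start_null_insert.prems(1) start_null_insert.hyps(3)] by blast
  have "grow_step g own t opn s Start (s\<lparr>heap := h\<rparr>) (Continue (CasRoot None (Some i)))"
    by (rule grow_stepI[OF g(1,2) start_null_insert.prems(2)]) (use g(3) in auto)
  then show ?case ..
next
  case (start_null_other s)
  then show ?case by (auto intro!: grow_step_same)
next
  case (test_null_insert s r k v i h)
  obtain g' own' where g: "heap_inv g' own' h" "grow g own (heap s) g' own' h" "root_inode g' h i"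
    using new_trie_grow[OF test_null_insert.prems(1) test_null_insert.hyps(3)] by blast
  have "grow_step g own t opn s (TestRoot r) (s\<lparr>heap := h\<rparr>) (Continue (CasRoot (Some r) (Some i)))"
    by (rule grow_stepI[OF g(1,2) test_null_insert.prems(2)]) (use g(3) in auto)
  then show ?case ..
next
  case (test_null_other s r)
  then show ?case by (auto intro!: grow_step_same)
next
  case (test_nonnull s r)
  then show ?case by (auto intro!: grow_step_same simp: visitable_path_def visitable_def root_inode_def)
next
  case (cas_root_insert k v e n s b s')
  then show ?case
    using cas_root_grow[OF cas_root_insert.prems cas_root_insert.hyps(2)] by auto
next
  case (cas_root_other e n s b s')
  then show ?case
    using cas_root_grow[OF cas_root_other.prems cas_root_other.hyps(2)] by auto
next
  case (visit_dead s i w lev anc)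
  then show ?case by (cases anc) (auto intro!: grow_step_same simp: visitable_path_def)
next
  case (visit_inode s i c b xs lev x w anc)
  note o = visited_cnode_public[OF visit_inode.prems(1) visit_inode.hyps(1,2)]
  have "x \<in> set (array_of (heap s) c)" "inode (heap s) x"
    using entry_SomeD(4)[OF heap_inv_CNode(1)[OF visit_inode.prems(1) visit_inode.hyps(2)]
        visit_inode.hyps(3)] visit_inode.hyps(2,4) by (auto simp: inode_def)
  then have "visitable_path g own (heap s) x (i # anc)"
    using visitable_path_child[OF visit_inode.prems(1) _ o] visit_inode.prems(3) by simp
  then show ?case using visit_inode.prems by (auto intro!: grow_step_same)
next
  case (insert_new k v s i c b xs lev y h1 c' h2 anc)
  show ?case using insert_new_step[OF insert_new.prems insert_new.hyps(2-6)] by (rule disjI1)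
next
  case (insert_same_key k v s i c b xs lev x u y h1 c' h2 anc)
  show ?case using insert_same_key_step[OF insert_same_key.prems insert_same_key.hyps(2-7)] by (rule disjI1)
next
  case (insert_other_key k v s i c b xs lev x k' u y h1 d h2 j h3 c' h4 anc)
  show ?case
    using insert_other_key_step[OF insert_other_key.prems insert_other_key.hyps(2-5,7-10)]
    by (rule disjI1)
next
  case (insert_cas i c n s b s')
  show ?case by (rule insert_cas_step[OF insert_cas.prems insert_cas.hyps refl])
next
  case (absent s i c b xs lev anc)
  then show ?case by (auto intro!: grow_step_same)
next
  case (mismatch s i c b xs lev x k' u anc)
  then show ?case by (auto intro!: grow_step_same)
next
  case (lookup_found k s i c b xs lev x u anc)
  then show ?case by (auto intro!: grow_step_same)
next
  case (remove_only_entry k s i c b xs lev x u anc)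
  then show ?case
    using visited_cnode_public[OF remove_only_entry.prems(1) remove_only_entry.hyps(2,3)]
    by (auto intro!: grow_step_same simp: is_remove_def)
next
  case (remove_entry k s i c b xs lev x u c' h anc)
  note o = visited_cnode_public[OF remove_entry.prems(1) remove_entry.hyps(2,3)]
  obtain g' own' where g: "heap_inv g' own' h" "grow g own (heap s) g' own' h" "private_cnode g' own' h t i c'"
    using removed_alloc[OF remove_entry.prems(1) o remove_entry.hyps(3,4,7)] by blast
  have "grow_step g own t opn s (Visit i lev anc) (s\<lparr>heap := h\<rparr>)
      (Continue (RemoveCas i c (Some c') lev anc u))"
    by (rule grow_stepI[OF g(1,2) remove_entry.prems(2)])
      (use g(3) grow_visit_evolves[OF g(2)] o remove_entry.prems(3) remove_entry.hyps(1)
        in \<open>auto simp: is_remove_def\<close>)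
  then show ?case ..
next
  case (remove_cas i c n s b s' u lev anc)
  show ?case by (rule remove_cas_step[OF remove_cas.prems remove_cas.hyps refl])
next
  case (clean_cnode s p c b xs)
  then show ?case
    using visited_cnode_public[OF clean_cnode.prems(1) clean_cnode.hyps] by (auto intro!: grow_step_same)
next
  case (clean_other s p)
  then show ?case by (auto intro!: grow_step_same)
next
  case (compress_single s c b x t' p)
  have "weight (heap s) x = 1"
    using compress_single.hyps by (intro weight_single[OF ext_refl] singleton_tomb) (auto simp: tomb_inode_def)
  then show ?case using compress_single.prems compress_single.hyps
    by (auto intro!: grow_step_same simp: null_or_tombed_def)
next
  case (compress_begin s c b xs p)
  then show ?case using partial_copy_start[OF compress_begin.prems(1) compress_begin.hyps(1)]
    by (auto intro!: grow_step_same)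
next
  case (compress_filter s p c ds e es)
  then show ?case using partial_copy_filter[of "heap s" c ds e es]
    by (auto intro!: grow_step_same)
next
  case (compress_filtered s p c ds)
  then show ?case by (auto intro!: grow_step_same)
next
  case (compress_resurrect s x t' k u y h p c ds j es)
  note 1 = snode_alloc[OF compress_resurrect.prems(1) grow_refl compress_resurrect.hyps(3)]
  note g = grow_visit_evolves[OF 1(2)]
  have o: "public_cnode g own (heap s) p c" "partial_copy (heap s) c (ds @ (j, x) # es)"
    using compress_resurrect.prems(3) by auto
  have "tomb_inode (heap s) x"
    using compress_resurrect.hyps by (auto simp: tomb_inode_def tombed_snode_def)
  then have "singleton h x" using ext_singleton[OF map_le_ext[OF 1(4)]] singleton_tomb by blast
  moreover have "snode h y" unfolding snode_def using 1(3) by blast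
  ultimately have "partial_copy h c ((ds @ [(j, y)]) @ es)" by (rule partial_copy_replace[OF g(5)[OF o]])
  moreover have "visitable g own h p" "public_cnode g own h p c"
    using g compress_resurrect.prems(3) by auto
  ultimately have "grow_step g own t opn s (CompressMap p c ds ((j, x) # es)) (s\<lparr>heap := h\<rparr>)
      (Continue (CompressMap p c (ds @ [(j, y)]) es))"
    by (intro grow_stepI[OF 1(1,2) compress_resurrect.prems(2)]) auto
  then show ?case ..
next
  case (compress_keep s e p c ds es)
  then show ?case by (auto intro!: grow_step_same)
next
  case (compress_empty s p c)
  \<comment> \<open>With an empty copy, the comparison says that the original weighs 0; this
    licenses the kill.\<close>
  then show ?case using partial_copy_total_weight[of "heap s" c "[]"]
    by (auto intro!: grow_step_same simp: null_or_tombed_def)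
next
  case (compress_nonempty ds s c' h p c)
  have o: "public_cnode g own (heap s) p c" "partial_copy (heap s) c ds"
    using compress_nonempty.prems(3) by auto
  obtain g' own' where g: "heap_inv g' own' h" "grow g own (heap s) g' own' h" "private_cnode g' own' h t p c'"
    "never_heavier h (array_of h c) (array_of h c')"
    using partial_copy_alloc[OF compress_nonempty.prems(1) o compress_nonempty.hyps(2)] by blast
  have "grow_step g own t opn s (CompressMap p c ds []) (s\<lparr>heap := h\<rparr>)
      (Continue (CleanCas p c (Some c')))"
    by (rule grow_stepI[OF g(1,2) compress_nonempty.prems(2)])
      (use g(3,4) grow_visit_evolves[OF g(2)] compress_nonempty.prems(3) in auto)
  then show ?case ..
next
  case (clean_cas p c n s b s')
  show ?case by (rule clean_cas_step[OF clean_cas.prems clean_cas.hyps])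
next
  case (tomb_read_cnode s i c b xs lev anc v)
  note cp = partial_copy_start[OF tomb_read_cnode.prems(1) tomb_read_cnode.hyps(2)]
  have "map snd (entries b xs) = xs"
    using entries_wf(1) heap_inv_CNode(1)[OF tomb_read_cnode.prems(1) tomb_read_cnode.hyps(2)] by blast
  \<comment> \<open>A run that starts on a light cnode satisfies the count in
    \<open>will_compress\<close>: at most one of its entries is not null.\<close>
  then have "length (filter (\<lambda>e. \<not> null_inode (heap s) (snd e)) (entries b xs)) \<le> 1"
    if "light_inode (heap s) i"
    using length_nonnull_le_total_weight[of "heap s" "entries b xs"]
      light_inode_total_weight[OF that tomb_read_cnode.hyps(1)] tomb_read_cnode.hyps(2) by simp
  then show ?case
    using tomb_read_cnode.prems cp visited_cnode_public[OF tomb_read_cnode.prems(1) tomb_read_cnode.hyps]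
    by (auto intro!: grow_step_same)
next
  case (tomb_read_other s i lev anc v)
  have "grow_step g own t opn s (TombCompress i lev anc v) s (to_caller W v lev anc)"
  proof (rule grow_step_same[OF tomb_read_other.prems(1,2)])
    show "out_ctl_inv g own (heap s) t opn (to_caller W v lev anc)"
      using to_caller_ok(1) tomb_read_other.prems(3) by auto
    \<comment> \<open>A light inode is live, so \<open>p\<close> is not \<open>i\<close> but an
      ancestor, and those are still covered on return to the caller.\<close>
    fix p assume "g p \<noteq> p" "light_inode (heap s) p" "will_compress (heap s) p (TombCompress i lev anc v)"
    then show "out_will_compress (heap s) p (to_caller W v lev anc)"
      using to_caller_ok(2)[of opn g own "heap s" i anc p] tomb_read_other.prems(3)
        tomb_read_other.hyps by (auto simp: light_inode_def live_inode_def)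
  qed
  then show ?case ..
next
  case (tomb_filter s i c ds e es lev anc v)
  then show ?case using partial_copy_filter[of "heap s" c ds e es]
    by (auto intro!: grow_step_same)
next
  case (tomb_unchanged ds s i c lev anc v)
  have "grow_step g own t opn s (TombFilter i c ds [] lev anc v) s (to_caller W v lev anc)"
  proof (rule grow_step_same[OF tomb_unchanged.prems(1,2)])
    show "out_ctl_inv g own (heap s) t opn (to_caller W v lev anc)"
      using to_caller_ok(1) tomb_unchanged.prems(3) by auto
    \<comment> \<open>Two retained entries contradict the count in \<open>will_compress\<close>, so
      the obligation can only concern an ancestor.\<close>
    fix p assume "g p \<noteq> p" "light_inode (heap s) p" "will_compress (heap s) p (TombFilter i c ds [] lev anc v)"
    then show "out_will_compress (heap s) p (to_caller W v lev anc)"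
      using to_caller_ok(2)[of opn g own "heap s" i anc p] tomb_unchanged.prems(3)
        tomb_unchanged.hyps by auto
  qed
  then show ?case ..
next
  case (tomb_null s i c lev anc v)
  then show ?case by (auto intro!: grow_step_same simp: null_or_tombed_def)
next
  case (tomb_snode s x k u b t' h i c j lev anc v)
  note 1 = snode_alloc[OF tomb_snode.prems(1) grow_refl tomb_snode.hyps(2)]
  have nt: "null_or_tombed h (Some t')" using 1(3) by (auto simp: null_or_tombed_def tombed_snode_def)
  have "grow_step g own t opn s (TombFilter i c [(j, x)] [] lev anc v) (s\<lparr>heap := h\<rparr>)
     (Continue (TombCas i c (Some t') lev anc v))"
    by (rule grow_stepI[OF 1(1,2) tomb_snode.prems(2)])
      (use tomb_snode.prems(3) grow_visit_evolves[OF 1(2)] nt in auto)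
  then show ?case ..
next
  case (tomb_tomb_inode s x z k u t' h i c j lev anc v)
  note 1 = snode_alloc[OF tomb_tomb_inode.prems(1) grow_refl tomb_tomb_inode.hyps(3)]
  have nt: "null_or_tombed h (Some t')" using 1(3) by (auto simp: null_or_tombed_def tombed_snode_def)
  have "grow_step g own t opn s (TombFilter i c [(j, x)] [] lev anc v) (s\<lparr>heap := h\<rparr>)
     (Continue (TombCas i c (Some t') lev anc v))"
    by (rule grow_stepI[OF 1(1,2) tomb_tomb_inode.prems(2)])
      (use tomb_tomb_inode.prems(3) grow_visit_evolves[OF 1(2)] nt in auto)
  then show ?case ..
next
  case (tomb_nonsingleton s x j c' h i c lev anc v)
  have o: "public_cnode g own (heap s) i c" "partial_copy (heap s) c [(j, x)]"
    using tomb_nonsingleton.prems(3) by auto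
  obtain g' own' where g: "heap_inv g' own' h" "grow g own (heap s) g' own' h" "private_cnode g' own' h t i c'"
    "never_heavier h (array_of h c) (array_of h c')"
    using partial_copy_alloc[OF tomb_nonsingleton.prems(1) o tomb_nonsingleton.hyps(2)] by blast
  \<comment> \<open>A responsible run on a light \<open>i\<close> does not get here with
    \<open>c\<close> still current: a retained entry that is neither null nor a singleton weighs 2.
    So the CAS is bound to fail, which \<open>will_compress\<close> accepts.\<close>
  have "h i \<noteq> Some (INode (Some c))"
    if p: "light_inode (heap s) i" "heap s i = Some (INode (Some c)) \<longrightarrow> \<not> null_inode (heap s) x"
  proof
    assume "h i = Some (INode (Some c))"
    moreover obtain nd where "heap s i = Some nd" using p(1) by (auto simp: light_inode_def)
    ultimately have i: "heap s i = Some (INode (Some c))" using map_leD[OF grow_le[OF g(2)]] by metis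
    then have "weight (heap s) x = 2" using p(2) tomb_nonsingleton.hyps(1) by (simp add: weight_def)
    then show False
      using light_inode_total_weight[OF p(1) i]
        weight_le_total_weight[OF in_partial_copy_entry[OF o(2) tomb_nonsingleton.hyps(1)], of "heap s"]
      by simp
  qed
  then have "grow_step g own t opn s (TombFilter i c [(j, x)] [] lev anc v) (s\<lparr>heap := h\<rparr>)
     (Continue (TombCas i c (Some c') lev anc v))"
    using g(3,4) grow_visit_evolves[OF g(2)] tomb_nonsingleton.prems(3)
    by (intro grow_stepI[OF g(1,2) tomb_nonsingleton.prems(2)]) auto
  then show ?case ..
next
  case (tomb_cas_success i c w s s' lev anc v)
  show ?case
    using tomb_cas_step[OF tomb_cas_success.prems tomb_cas_success.hyps refl] by (rule disjI2)
next
  case (tomb_cas_failure i c w s s' lev anc v)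
  then show ?case using cas_mainD[OF tomb_cas_failure.hyps] by (auto intro!: grow_step_same)
next
  case (contract_read s i m lev anc v)
  then show ?case by (auto intro!: grow_step_same)
next
  case (contract_null s p c b xs lev i c' h anc v)
  note o = visited_cnode_public[OF contract_null.prems(1) contract_null.hyps(1,2)]
  obtain g' own' where g: "heap_inv g' own' h" "grow g own (heap s) g' own' h" "private_cnode g' own' h t p c'"
    using removed_alloc[OF contract_null.prems(1) o contract_null.hyps(2-4)] by blast
  have "grow_step g own t opn s (ContractParent i None lev (p # anc) v) (s\<lparr>heap := h\<rparr>)
      (Continue (ContractCas i c c' lev (p # anc) v))"
    by (rule grow_stepI[OF g(1,2) contract_null.prems(2)])
      (use g(3) grow_visit_evolves[OF g(2)] o contract_null.prems(3) in auto)
  then show ?case ..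
next
  case (contract_tombed s p c b xs lev i t' k u y h1 c' h2 anc v)
  show ?case
    using contract_tombed_step[OF contract_tombed.prems contract_tombed.hyps(1-3,5,6)] by (rule disjI1)
next
  case (contract_none s p lev i m anc v)
  have "grow_step g own t opn s (ContractParent i m lev (p # anc) v) s (to_caller W v lev (p # anc))"
  proof (rule grow_step_same[OF contract_none.prems(1,2)])
    show "out_ctl_inv g own (heap s) t opn (to_caller W v lev (p # anc))"
      using to_caller_ok(1)[of opn g own "heap s" i "p # anc"] contract_none.prems(3)
      by (auto simp del: to_caller.simps)
    fix q assume "g q \<noteq> q" "light_inode (heap s) q" "will_compress (heap s) q (ContractParent i m lev (p # anc) v)"
    then show "out_will_compress (heap s) q (to_caller W v lev (p # anc))"
      using to_caller_ok(2)[of opn g own "heap s" i "p # anc" q] contract_none.prems(3)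
      by (auto simp del: to_caller.simps)
  qed
  then show ?case ..
next
  case (contract_cas p c c' s b s' v lev anc i)
  show ?case by (rule contract_cas_step[OF contract_cas.prems contract_cas.hyps refl])
qed

section \<open>Preservation of the invariant\<close>

lemma will_compress_grow:
  assumes st: "heap_inv g own h" and gr: "grow g own h g' own' h'"
    and ctl_inv: "ctl_inv g own h t opn ctl" and p: "will_compress h p ctl"
  shows "will_compress h' p ctl"
proof -
  have le: "h \<subseteq>\<^sub>m h'" using gr by (rule grow_le)
  note e = map_le_ext[OF le]
  have same: "h' x = h x" if "inode h x \<or> snode h x" for x
    using that map_leD[OF le] by (auto simp: inode_def snode_def)
  show ?thesis
  proof (cases ctl)
    case (TombFilter i c ds es lev anc v)
    have o: "public_cnode g own h i c" and cp: "partial_copy h c (ds @ es)" and i: "inode h i"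
      using ctl_inv TombFilter by (auto simp: visitable_path_def visitable_def)
    have "null_inode h' (snd d) = null_inode h (snd d)" if "d \<in> set (ds @ es)" for d
    proof -
      have "inode h (snd d) \<or> snode h (snd d)"
        using cp that public_cnode_entry[OF st o, of "snd d"] unfolding partial_copy_def by blast
      then show ?thesis using same by (simp add: null_inode_def)
    qed
    then show ?thesis using p TombFilter same[of i] i by (auto cong: filter_cong)
  next
    case (TombCas i c w lev anc v)
    have "inode h i" using ctl_inv TombCas by (auto simp: visitable_path_def visitable_def)
    then show ?thesis using p TombCas same[of i] null_or_tombed_ext[OF e, of w] by auto
  qed (use p in auto)
qed

lemma hidden_live_inode:
  assumes "heap_inv g own h" "hidden_live h c j" "private_cnode g own h t i c"
  shows "inode h j" "g j \<noteq> j" "\<not> public_entry own h j"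
proof -
  obtain b xs where c: "h c = Some (CNode b xs)" "own c = Some t" "j \<in> set xs" "weight h j = 2"
    using assms(2,3) by (auto simp: private_cnode_def hidden_live_def)
  then have "\<not> snode h j" using weight_snode[of h j] by auto
  then show "inode h j" "g j \<noteq> j" using heap_inv_CNode(2)[OF assms(1) c(1,3)] by auto
  show "\<not> public_entry own h j" using assms(2) c(2) by (auto simp: public_entry_def hidden_live_def)
qed

text \<open>A new cnode may contain an old inode only if that was a published entry, which a hidden
  one is not.\<close>

lemma hidden_live_grow:
  assumes "heap_inv g own h" "grow g own h g' own' h'" "hidden_live h c j" "private_cnode g own h t i c"
  shows "hidden_live h' c j"
proof -
  note j = hidden_live_inode[OF assms(1,3,4)]
  have le: "h \<subseteq>\<^sub>m h'" using assms(2) by (rule grow_le)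
  have "array_of h' c = array_of h c" using assms(4) map_leD[OF le] by (fastforce simp: private_cnode_def)
  moreover have "weight h' j = weight h j" by (rule weight_map_le[OF assms(1) le inode_dom[OF j(1)]])
  moreover have "d = c" if d: "h' d = Some (CNode b xs)" "j \<in> set xs" for d b xs
  proof (cases "h d")
    case None
    then have "public_entry own h j" using d j(1) assms(2) unfolding grow_def by blast
    then show ?thesis using j(3) by simp
  next
    case (Some nd)
    then have "h d = Some (CNode b xs)" using d(1) map_leD[OF le Some] by simp
    then show ?thesis using assms(3) d(2) by (auto simp: hidden_live_def)
  qed
  ultimately show ?thesis using assms(3) by (auto simp: hidden_live_def)
qed

text \<open>The content of an inode is never an inode, so looking through the reference held by
  \<open>x\<close> cannot meet \<open>i\<close>.\<close>

lemma weight_cas: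
  assumes "heap_inv g own h" "inode h i" "x \<noteq> i"
  shows "weight (h(i \<mapsto> INode n)) x = weight h x"
proof -
  have m: "m \<noteq> i" if "h x = Some (INode (Some m))" for m
    using heap_inv_INode[OF assms(1) that] assms(2) by (auto simp: inode_def tombed_snode_def)
  have "tomb_inode (h(i \<mapsto> INode n)) x = tomb_inode h x"
    using assms(3) m by (auto simp: tomb_inode_def tombed_snode_def)
  then show ?thesis using assms(3) by (simp add: weight_def null_inode_def singleton_def)
qed

text \<open>The target of a CAS is visitable, and a hidden inode is neither a ghost root nor a
  published entry.\<close>

lemma hidden_live_cas:
  assumes st: "heap_inv g own h" and i: "visitable g own h i"
    and s: "hidden_live h c j" "private_cnode g own h t i' c"
  shows "hidden_live (h(i \<mapsto> INode n)) c j"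
proof -
  note j = hidden_live_inode[OF st s]
  have "j \<noteq> i" using i j by (auto simp: visitable_def)
  then have "weight (h(i \<mapsto> INode n)) j = weight h j"
    using weight_cas[OF st] i by (auto simp: visitable_def)
  moreover have ci: "c \<noteq> i" using i s(2) by (auto simp: visitable_def inode_def private_cnode_def)
  moreover from ci have "array_of (h(i \<mapsto> INode n)) c = array_of h c" by (simp add: array_of_def)
  moreover have "h d = Some (CNode b xs)" if "(h(i \<mapsto> INode n)) d = Some (CNode b xs)" for d b xs
    using that by (simp split: if_splits)
  ultimately show ?thesis using s(1) unfolding hidden_live_def by (simp del: fun_upd_apply)
qed

lemma heap_inv_cas:
  assumes st: "heap_inv g own h" and i: "inode h i"
    and n: "\<And>m. n = Some m \<Longrightarrow>
      (\<exists>b xs. h m = Some (CNode b xs)) \<and> g m = i \<and> own' m = None \<or> tombed_snode h m"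
    and own: "\<And>x. own x = None \<Longrightarrow> own' x = None"
  shows "heap_inv g own' (h(i \<mapsto> INode n))"
  unfolding heap_inv_def
proof (intro conjI allI impI)
  fix c b xs assume "(h(i \<mapsto> INode n)) c = Some (CNode b xs)"
  then have c: "h c = Some (CNode b xs)" by (auto split: if_splits)
  show "wf_cnode b xs" by (rule heap_inv_CNode(1)[OF st c])
  show "\<forall>x\<in>set xs. snode (h(i \<mapsto> INode n)) x \<or>
      inode (h(i \<mapsto> INode n)) x \<and> g x = g c \<and> g x \<noteq> x"
  proof
    fix x assume "x \<in> set xs"
    then consider "snode h x" | "inode h x" "g x = g c" "g x \<noteq> x"
      using heap_inv_CNode(2)[OF st c] by blast
    then show "snode (h(i \<mapsto> INode n)) x \<or>
      inode (h(i \<mapsto> INode n)) x \<and> g x = g c \<and> g x \<noteq> x"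
      using i by cases (auto simp: snode_def inode_def)
  qed
next
  fix p m assume p: "(h(i \<mapsto> INode n)) p = Some (INode (Some m))"
  show "(\<exists>b xs. (h(i \<mapsto> INode n)) m = Some (CNode b xs) \<and> g m = p \<and> own' m = None) \<or>
      tombed_snode (h(i \<mapsto> INode n)) m"
  proof (cases "p = i")
    case True
    then show ?thesis using n[of m] p i by (auto simp: tombed_snode_def inode_def)
  next
    case False
    then have "h p = Some (INode (Some m))" using p by simp
    then show ?thesis using heap_inv_INode[OF st, of p m] own[of m] i
      by (auto simp: tombed_snode_def inode_def)
  qed
qed

text \<open>An obligation can break in one way only: a scan at \<open>g i\<close> has already
  retained \<open>i\<close>, which now becomes a null-inode. Emptying an entry not yet scanned
  merely lowers the count. As \<open>n\<close> is no published cnode, the CAS cannot reinstate a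
  stale \<open>c\<close> and thereby reactivate the conditions on the current content.\<close>

lemma will_compress_cas:
  assumes st: "heap_inv g own h" and i: "h i = Some (INode (Some c0))" "public_cnode g own h i c0"
    and ctl_inv: "ctl_inv g own h t opn ctl" and p: "will_compress h p ctl"
    and n: "n = None \<Longrightarrow> p \<noteq> g i" "\<And>c i'. n = Some c \<Longrightarrow> \<not> public_cnode g own h i' c"
  shows "will_compress (h(i \<mapsto> INode n)) p ctl"
proof -
  let ?h = "h(i \<mapsto> INode n)"
  note e = cas_ext[OF i, of n]
  show ?thesis
  proof (cases ctl)
    case (TombFilter i0 c ds es lev anc v)
    have o: "public_cnode g own h i0 c" and cp: "partial_copy h c (ds @ es)"
      using ctl_inv TombFilter by auto
    have f: "length (filter (\<lambda>e. \<not> null_inode ?h (snd e)) es) \<le>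
        length (filter (\<lambda>e. \<not> null_inode h (snd e)) es)"
      using ext_null[OF e] by (induction es) auto
    have "\<not> null_inode ?h (snd d)"
      if d: "d \<in> set ds" "\<not> null_inode h (snd d)" and m: "p = i0" "?h i0 = Some (INode (Some c))" for d
    proof
      assume "null_inode ?h (snd d)"
      with d(2) have di: "snd d = i" "n = None" by (auto simp: null_inode_def split: if_splits)
      have "snd d \<in> set (array_of h c)"
        using cp d(1) di(1) i(1) unfolding partial_copy_def by (auto simp: snode_def)
      then have "g i = i0" using public_cnode_entry[OF st o, of i] di(1) i(1) by (auto simp: snode_def)
      then show False using n(1)[OF di(2)] m(1) by simp
    qed
    moreover have "h i0 = Some (INode (Some c))" if "?h i0 = Some (INode (Some c))"
      using that n(2)[of c i0] o by (auto split: if_splits)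
    ultimately show ?thesis using p TombFilter f by fastforce
  next
    case (TombCas i0 c w lev anc v)
    have "public_cnode g own h i0 c" using ctl_inv TombCas by auto
    then have "h i0 = Some (INode (Some c))" if "?h i0 = Some (INode (Some c))"
      using that n(2)[of c i0] by (auto split: if_splits)
    then show ?thesis using p TombCas null_or_tombed_ext[OF e, of w] by auto
  qed (use p in auto)
qed

lemma chain_parent_mem:
  "chain g i anc \<Longrightarrow> x \<in> set (i # anc) \<Longrightarrow> g (g x) \<noteq> g x \<Longrightarrow> g x \<in> set anc"
proof (induction anc arbitrary: i)
  case (Cons p anc)
  then show ?case by (cases "x = i") auto
qed auto

text \<open>The parent lies in \<open>anc\<close>, the part of \<open>will_compress\<close> that
  does not depend on the heap; hence \<open>h'\<close> is arbitrary.\<close>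

lemma will_compress_parent:
  assumes "ctl_inv g own h t opn ctl" "will_compress h i ctl" "g (g i) \<noteq> g i"
  shows "will_compress h' (g i) ctl"
  using assms chain_parent_mem[of g _ _ i]
  by (cases ctl) (auto simp: visitable_path_def)

definition next_thread :: "('k, 'v) operation \<Rightarrow> 'v outcome \<Rightarrow> ('k, 'v) thread" where
  "next_thread opn out = (case out of Continue ctl \<Rightarrow> Busy opn ctl | Return r \<Rightarrow> Idle)"

definition compression_due :: "('t \<Rightarrow> ('k, 'v) thread) \<Rightarrow> ('k, 'v) heap \<Rightarrow> ref \<Rightarrow> bool" where
  "compression_due T h p \<longleftrightarrow> (\<exists>t opn ctl. T t = Busy opn ctl \<and> will_compress h p ctl)"

text \<open>The last clause ranges over all non-root inodes of the heap, including those not yet or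
  no longer in the trie, so that no step needs an argument about reachability.\<close>

definition config_inv :: "(ref \<Rightarrow> ref) \<Rightarrow> (ref \<Rightarrow> 't option) \<Rightarrow> ('t, 'k, 'v) config \<Rightarrow> bool" where
  "config_inv g own \<sigma> \<longleftrightarrow> heap_inv g own (heap (fst \<sigma>)) \<and> root_inv g (fst \<sigma>) \<and>
     (\<forall>t opn ctl. snd \<sigma> t = Busy opn ctl \<longrightarrow> ctl_inv g own (heap (fst \<sigma>)) t opn ctl) \<and>
     (\<forall>p. g p \<noteq> p \<and> light_inode (heap (fst \<sigma>)) p \<longrightarrow> compression_due (snd \<sigma>) (heap (fst \<sigma>)) p)"

lemma compression_due_out: "out_will_compress h p out \<Longrightarrow> compression_due (T(t := next_thread opn out)) h p"
  by (auto simp: compression_due_def next_thread_def out_will_compress_def split: outcome.splits)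

lemma compression_due_other:
  "T t' = Busy opn' ctl \<Longrightarrow> t' \<noteq> t \<Longrightarrow> will_compress h p ctl \<Longrightarrow> compression_due (T(t := X)) h p"
  by (auto simp: compression_due_def)

lemma threads_ctl_inv:
  assumes "out_ctl_inv g own h t opn out"
    and "\<And>t' opn' ctl'. t' \<noteq> t \<Longrightarrow> T t' = Busy opn' ctl' \<Longrightarrow> ctl_inv g own h t' opn' ctl'"
    and "(T(t := next_thread opn out)) t' = Busy opn' ctl'"
  shows "ctl_inv g own h t' opn' ctl'"
  using assms by (cases "t' = t") (auto simp: next_thread_def out_ctl_inv_def split: outcome.splits)

section \<open>Both kinds of step preserve the configuration invariant\<close>

lemma config_inv_grow:
  assumes inv: "config_inv g own (s, T)" and T: "T t = Busy opn ctl"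
    and gs: "grow_step g own t opn s ctl s' out"
  shows "\<exists>g' own'. config_inv g' own' (s', T(t := next_thread opn out))"
proof -
  have st: "heap_inv g own (heap s)"
    and ctl_inv: "\<And>t opn ctl. T t = Busy opn ctl \<Longrightarrow> ctl_inv g own (heap s) t opn ctl"
    and pd: "\<And>p. g p \<noteq> p \<Longrightarrow> light_inode (heap s) p \<Longrightarrow> compression_due T (heap s) p"
    using inv by (auto simp: config_inv_def)
  obtain g' own' where g: "heap_inv g' own' (heap s')" "grow g own (heap s) g' own' (heap s')"
    "root_inv g' s'" "out_ctl_inv g' own' (heap s') t opn out"
    and op: "\<And>p. g p \<noteq> p \<Longrightarrow> light_inode (heap s) p \<Longrightarrow>
      will_compress (heap s) p ctl \<Longrightarrow> out_will_compress (heap s') p out"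
    using gs unfolding grow_step_def by blast
  have le: "heap s \<subseteq>\<^sub>m heap s'" using g(2) by (rule grow_le)
  have ti': "ctl_inv g' own' (heap s') t' opn' ctl'" if "T t' = Busy opn' ctl'" for t' opn' ctl'
    by (rule ctl_inv_evolves[OF grow_evolves[OF g(2)] _ _ ctl_inv[OF that]])
      (use hidden_live_grow[OF st g(2)] in auto)
  have "compression_due (T(t := next_thread opn out)) (heap s') p"
      if p: "g' p \<noteq> p" "light_inode (heap s') p" for p
  proof -
    obtain c b xs where c: "heap s' p = Some (INode (Some c))" "heap s' c = Some (CNode b xs)"
      "total_weight (heap s') xs \<le> 1" using p(2) by (auto simp: light_inode_def)
    \<comment> \<open>By \<open>grow\<close>, a new inode is a root or leads to a cnode of weight at
      least 2, so a light non-root inode is old.\<close>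
    have "heap s p \<noteq> None"
    proof
      assume "heap s p = None"
      then have "\<exists>c' b xs. Some c = Some c' \<and> heap s' c' = Some (CNode b xs) \<and> 2 \<le> total_weight (heap s') xs"
        using g(2) c(1) p(1) unfolding grow_def by blast
      then show False using c(2,3) by auto
    qed
    then have hp: "heap s p = Some (INode (Some c))"
      using c(1) map_leD[OF le] by auto
    have gp: "g p \<noteq> p" using g(2) p(1) domI[where m = "heap s", OF hp] by (simp add: grow_def)
    then have hc: "heap s c = Some (CNode b xs)"
      using heap_inv_INode[OF st hp] c(2) map_leD[OF le] by (fastforce simp: tombed_snode_def)
    have tip: "light_inode (heap s) p"
      using hp hc c(3) total_weight_map_le[OF st le hc] by (auto simp: light_inode_def)
    obtain t0 opn0 ctl0 where 0: "T t0 = Busy opn0 ctl0" "will_compress (heap s) p ctl0"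
      using pd[OF gp tip] by (auto simp: compression_due_def)
    show ?thesis
    proof (cases "t0 = t")
      case True
      then show ?thesis using op[OF gp tip] 0 T by (auto intro: compression_due_out)
    next
      case False
      show ?thesis
        by (rule compression_due_other[where T = T and t' = t0, OF 0(1) False
              will_compress_grow[OF st g(2) ctl_inv[OF 0(1)] 0(2)]])
    qed
  qed
  then have "config_inv g' own' (s', T(t := next_thread opn out))"
    unfolding config_inv_def fst_conv snd_conv
    by (intro conjI allI impI g(1,3) threads_ctl_inv[OF g(4) ti']; (elim conjE)?; blast?)
  then show ?thesis by blast
qed

lemma config_inv_cas:
  assumes inv: "config_inv g own (s, T)" and T: "T t = Busy opn ctl"
    and cs: "cas_step g own t opn s ctl s' out"
  shows "\<exists>own'. config_inv g own' (s', T(t := next_thread opn out))"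
proof -
  have st: "heap_inv g own (heap s)" and r: "root_inv g s"
    and ctl_inv: "\<And>t opn ctl. T t = Busy opn ctl \<Longrightarrow> ctl_inv g own (heap s) t opn ctl"
    and pd: "\<And>p. g p \<noteq> p \<Longrightarrow> light_inode (heap s) p \<Longrightarrow> compression_due T (heap s) p"
    using inv by (auto simp: config_inv_def)
  obtain i c n own' where
    i: "heap s i = Some (INode (Some c))" "public_cnode g own (heap s) i c" and ok: "visitable g own (heap s) i"
    and s': "s' = s\<lparr>heap := (heap s)(i \<mapsto> INode n)\<rparr>"
    and ot: "out_ctl_inv g own' (heap s') t opn out"
    and op: "\<And>p. g p \<noteq> p \<Longrightarrow> p \<noteq> i \<Longrightarrow> will_compress (heap s) p ctl \<Longrightarrow> out_will_compress (heap s') p out"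
    and alt: "null_or_tombed (heap s) n \<and> own' = own \<and>
        (g (g i) \<noteq> g i \<longrightarrow> out_will_compress (heap s') (g i) out \<or>
           total_weight (heap s) (array_of (heap s) c) \<le> 1 \<and> \<not> will_compress (heap s) i ctl) \<or>
      (\<exists>c'. n = Some c' \<and> private_cnode g own (heap s) t i c' \<and> own' = own(c' := None) \<and>
        (g i \<noteq> i \<and> total_weight (heap s) (array_of (heap s) c') \<le> 1 \<longrightarrow> out_will_compress (heap s') i out \<or>
           total_weight (heap s) (array_of (heap s) c) \<le> 1 \<and> \<not> will_compress (heap s) i ctl))"
    using cs unfolding cas_step_def by blast
  have hs': "heap s' = (heap s)(i \<mapsto> INode n)" using s' by simp
  have ii: "inode (heap s) i" using i(1) by (simp add: inode_def)
  have live: "live_inode (heap s) i" using i by (auto simp: live_inode_def public_cnode_def)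
  have r': "root_inv g s'"
    using r root_inode_evolves[OF cas_evolves_null[OF i, of n]] s' by (simp add: root_inv_def)
  \<comment> \<open>Excludes the ABA problem: the new value is null, a tombed snode, or a cnode
    still owned by the writer.\<close>
  have nold: "\<not> public_cnode g own (heap s) i' c'" if "n = Some c'" for c' i'
    using alt that by (auto simp: null_or_tombed_def tombed_snode_def private_cnode_def public_cnode_def)
  have tipi: "light_inode (heap s) i" if "total_weight (heap s) (array_of (heap s) c) \<le> 1"
    using i that by (auto simp: light_inode_def public_cnode_def)
  \<comment> \<open>Excepted are \<open>i\<close>, if the writer itself was responsible for it, and
    the parent of an emptied inode; both are treated separately below.\<close>
  have keep: "compression_due (T(t := next_thread opn out)) (heap s') p"
    if p: "g p \<noteq> p" "light_inode (heap s) p" "p \<noteq> i \<or> \<not> will_compress (heap s) i ctl" "n = None \<Longrightarrow> p \<noteq> g i" for p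
  proof -
    obtain t0 opn0 ctl0 where 0: "T t0 = Busy opn0 ctl0" "will_compress (heap s) p ctl0"
      using pd[OF p(1,2)] by (auto simp: compression_due_def)
    show ?thesis
    proof (cases "t0 = t")
      case True
      then show ?thesis using op[OF p(1)] p(3) 0 T by (auto intro: compression_due_out)
    next
      case False
      have "will_compress (heap s') p ctl0"
        unfolding hs' by (rule will_compress_cas[OF st i ctl_inv[OF 0(1)] 0(2) p(4) nold])
      then show ?thesis by (rule compression_due_other[where T = T and t' = t0, OF 0(1) False])
    qed
  qed
  have pdec: "\<exists>c b xs. heap s p = Some (INode (Some c)) \<and> heap s c = Some (CNode b xs) \<and>
      total_weight (heap s') xs \<le> 1" if "light_inode (heap s') p" "p \<noteq> i" for p
    using that hs' by (auto simp: light_inode_def split: if_splits)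
  from alt show ?thesis
  proof
    assume a: "null_or_tombed (heap s) n \<and> own' = own \<and>
        (g (g i) \<noteq> g i \<longrightarrow> out_will_compress (heap s') (g i) out \<or>
           total_weight (heap s) (array_of (heap s) c) \<le> 1 \<and> \<not> will_compress (heap s) i ctl)"
    then have own': "own' = own" by simp
    have st': "heap_inv g own (heap s')"
      unfolding hs' by (rule heap_inv_cas[OF st ii]) (use a in \<open>auto simp: null_or_tombed_def\<close>)
    have ti': "ctl_inv g own (heap s') t' opn' ctl'" if "T t' = Busy opn' ctl'" for t' opn' ctl'
      unfolding hs' by (rule ctl_inv_evolves[OF cas_evolves_null[OF i] _ _ ctl_inv[OF that]])
        (use hidden_live_cas[OF st ok] in auto)
    have "compression_due (T(t := next_thread opn out)) (heap s') p"
      if p: "g p \<noteq> p" "light_inode (heap s') p" for p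
    proof -
      have pi: "p \<noteq> i"
        using p(2) hs' a by (auto simp: light_inode_def null_or_tombed_def tombed_snode_def split: if_splits)
      obtain d b xs where d: "heap s p = Some (INode (Some d))" "heap s d = Some (CNode b xs)"
        "total_weight (heap s') xs \<le> 1" using pdec[OF p(2) pi] by blast
      show ?thesis
      proof (cases "p = g i")
        case True
        show ?thesis
        proof (cases "out_will_compress (heap s') (g i) out")
          case True
          then show ?thesis unfolding \<open>p = g i\<close> by (rule compression_due_out)
        next
          case False
          then have w: "total_weight (heap s) (array_of (heap s) c) \<le> 1" "\<not> will_compress (heap s) i ctl"
            using a p(1) True by auto
          \<comment> \<open>The writer takes on nothing, as after a clean. But \<open>i\<close> was
            light, so some other thread was responsible for it, and that thread has the parent on
            its stack.\<close>
          have "g i \<noteq> i" using p(1) True by auto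
          then obtain t0 opn0 ctl0 where 0: "T t0 = Busy opn0 ctl0" "will_compress (heap s) i ctl0"
            using pd[OF _ tipi[OF w(1)]] by (auto simp: compression_due_def)
          have "t0 \<noteq> t" using 0 T w(2) by auto
          moreover have "will_compress (heap s') p ctl0"
            using will_compress_parent[OF ctl_inv[OF 0(1)] 0(2)] True p(1) by auto
          ultimately show ?thesis by (rule compression_due_other[where T = T and t' = t0, OF 0(1)])
        qed
      next
        case False
        \<comment> \<open>All inode entries of \<open>d\<close> have ghost parent \<open>p\<close>.
          As \<open>p\<close> is not \<open>g i\<close>, the killed inode is not among them, so the
          total weight is the same as before.\<close>
        have gd: "g d = p" using heap_inv_INode[OF st d(1)] d(2) by (auto simp: tombed_snode_def)
        have "x \<noteq> i" if "x \<in> set xs" for x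
          using heap_inv_CNode(2)[OF st d(2) that] gd False ii by (auto simp: inode_def snode_def)
        then have "total_weight (heap s') xs = total_weight (heap s) xs"
          unfolding hs' by (intro total_weight_cong weight_cas[OF st ii]) auto
        then have "light_inode (heap s) p" using d by (auto simp: light_inode_def)
        then show ?thesis using keep[OF p(1)] pi False by blast
      qed
    qed
    then have "config_inv g own (s', T(t := next_thread opn out))"
      unfolding config_inv_def fst_conv snd_conv
      by (intro conjI allI impI st' r' threads_ctl_inv[OF ot[unfolded own'] ti']; (elim conjE)?; blast?)
    then show ?thesis by blast
  next
    assume "\<exists>c'. n = Some c' \<and> private_cnode g own (heap s) t i c' \<and> own' = own(c' := None) \<and>
        (g i \<noteq> i \<and> total_weight (heap s) (array_of (heap s) c') \<le> 1 \<longrightarrow> out_will_compress (heap s') i out \<or>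
           total_weight (heap s) (array_of (heap s) c) \<le> 1 \<and> \<not> will_compress (heap s) i ctl)"
    then obtain c' where n: "n = Some c'" and c': "private_cnode g own (heap s) t i c'"
      and own': "own' = own(c' := None)"
      and a: "g i \<noteq> i \<Longrightarrow> total_weight (heap s) (array_of (heap s) c') \<le> 1 \<Longrightarrow> out_will_compress (heap s') i out \<or>
           total_weight (heap s) (array_of (heap s) c) \<le> 1 \<and> \<not> will_compress (heap s) i ctl" by blast
    have oc: "own c' = Some t" using c' by (simp add: private_cnode_def)
    have st': "heap_inv g own' (heap s')"
      unfolding hs' by (rule heap_inv_cas[OF st ii]) (use n c' own' in \<open>auto simp: private_cnode_def\<close>)
    have ti': "ctl_inv g own' (heap s') t' opn' ctl'" if "t' \<noteq> t" "T t' = Busy opn' ctl'" for t' opn' ctl'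
      unfolding hs' own' by (rule ctl_inv_evolves[OF cas_evolves_new[OF i oc] _ _ ctl_inv[OF that(2)]])
        (use hidden_live_cas[OF st ok] that(1) in auto)
    obtain b' ys where ys: "heap s c' = Some (CNode b' ys)" using c' by (auto simp: private_cnode_def)
    have ic: "c' \<noteq> i" using ys i(1) by auto
    have live': "live_inode (heap s') i" using hs' n ys ic by (auto simp: live_inode_def)
    \<comment> \<open>\<open>i\<close> is live before and after, hence weighs 2 both times, and no
      other weight depends on its content.\<close>
    have weight: "weight (heap s') x = weight (heap s) x" for x
      using weight_cas[OF st ii, of x n] weight_live[OF live] weight_live[OF live'] hs' by (cases "x = i") auto
    then have total_weight: "total_weight (heap s') xs = total_weight (heap s) xs" for xs by (intro total_weight_cong)
    have "compression_due (T(t := next_thread opn out)) (heap s') p"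
      if p: "g p \<noteq> p" "light_inode (heap s') p" for p
    proof (cases "p = i")
      case False
      then have "light_inode (heap s) p" using pdec[OF p(2)] total_weight by (auto simp: light_inode_def)
      then show ?thesis using keep[OF p(1)] False n by blast
    next
      case True
      then have "total_weight (heap s) (array_of (heap s) c') \<le> 1"
        using p(2) hs' n ys ic total_weight by (auto simp: light_inode_def)
      then consider "out_will_compress (heap s') i out" |
        "total_weight (heap s) (array_of (heap s) c) \<le> 1" "\<not> will_compress (heap s) i ctl"
        using a p(1) True by blast
      then show ?thesis
      proof cases
        case 1
        then show ?thesis unfolding True by (rule compression_due_out)
      next
        case 2
        then show ?thesis using keep[OF p(1)] tipi True n by blast
      qed
    qed
    then have "config_inv g own' (s', T(t := next_thread opn out))"
      unfolding config_inv_def fst_conv snd_conv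
      by (intro conjI allI impI st' r' threads_ctl_inv[OF ot ti']; (elim conjE)?; blast?)
    then show ?thesis by blast
  qed
qed

lemma config_inv_sys_step:
  assumes "sys_step W hc \<sigma> \<sigma>'" "config_inv g own \<sigma>"
  shows "\<exists>g' own'. config_inv g' own' \<sigma>'"
proof -
  have stp: "\<exists>g' own'. config_inv g' own' (s', T(t := next_thread opn out))"
    if "config_inv g own (s, T)" "T t = Busy opn c" "step W hc opn s c s' out" for s T t opn c s' out
  proof -
    have "grow_step g own t opn s c s' out \<or> cas_step g own t opn s c s' out"
      by (rule step_cases[OF that(3)]) (use that(1,2) in \<open>auto simp: config_inv_def\<close>)
    then show ?thesis
    proof
      assume "grow_step g own t opn s c s' out"
      then show ?thesis by (rule config_inv_grow[OF that(1,2)])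
    next
      assume "cas_step g own t opn s c s' out"
      from config_inv_cas[OF that(1,2) this] obtain own' where
        "config_inv g own' (s', T(t := next_thread opn out))" ..
      then show ?thesis by (intro exI)
    qed
  qed
  show ?thesis
    using assms
  proof cases
    case (invoke T t s opn)
    \<comment> \<open>An idle thread carries no obligation, so none is lost when it begins an
      operation.\<close>
    have "compression_due (T(t := Busy opn Start)) h p" if pT: "compression_due T h p" for h p
    proof -
      obtain t' opn' ctl where t': "T t' = Busy opn' ctl" "will_compress h p ctl"
        using pT by (auto simp: compression_due_def)
      moreover have "t' \<noteq> t" using t'(1) invoke(3) by auto
      ultimately show ?thesis by (intro compression_due_other[where T = T and t' = t'])
    qed
    then have "config_inv g own \<sigma>'" using assms(2) invoke by (auto simp: config_inv_def)
    then show ?thesis by blast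
  next
    case (proceed T t opn c s s' c')
    then show ?thesis using stp[of s T t opn c s' "Continue c'"] assms(2) by (simp add: next_thread_def)
  next
    case (complete T t opn c s s' r)
    then show ?thesis using stp[of s T t opn c s' "Return r"] assms(2) by (simp add: next_thread_def)
  qed
qed

lemma config_inv_reachable:
  assumes "reachable W hc \<sigma>"
  shows "\<exists>g own. config_inv g own \<sigma>"
  using assms unfolding reachable_def
proof (induction rule: rtranclp_induct)
  case base
  show ?case by (auto simp: config_inv_def initial_def heap_inv_def root_inv_def light_inode_def)
next
  case (step \<sigma> \<sigma>')
  then show ?case using config_inv_sys_step by blast
qed

lemma will_compress_is_remove: "ctl_inv g own h t opn ctl \<Longrightarrow> will_compress h p ctl \<Longrightarrow> is_remove opn"
  by (cases ctl) auto

text \<open>\<open>heap_inv\<close> leaves no dangling references, so an entry that is not a live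
  inode is a null-inode or a singleton, and the total weight just counts the singletons.\<close>

lemma tip_total_weight:
  assumes st: "heap_inv g own h" and c: "h c = Some (CNode b xs)" and tip: "tip h c"
  shows "total_weight h xs \<le> 1"
proof -
  have "weight h x = (if singleton h x then 1 else 0)" if x: "x \<in> set xs" for x
  proof -
    have "\<not> live_inode h x" using tip c x by (auto simp: tip_def)
    have "null_inode h x \<or> singleton h x"
    proof (cases "snode h x")
      case True
      then show ?thesis by (auto simp: snode_def singleton_def)
    next
      case False
      then obtain w where w: "h x = Some (INode w)"
        using heap_inv_CNode(2)[OF st c x] by (auto simp: inode_def)
      show ?thesis
      proof (cases w)
        case None
        then show ?thesis using w by (simp add: null_inode_def)
      next
        case (Some m)
        then have "tomb_inode h x"
          using heap_inv_INode[OF st, of x m] w \<open>\<not> live_inode h x\<close>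
          by (auto simp: live_inode_def tomb_inode_def)
        then show ?thesis by (simp add: singleton_def)
      qed
    qed
    then show ?thesis using not_null_singleton[of h x] by (auto simp: weight_def)
  qed
  then have "total_weight h xs = length (filter (singleton h) xs)"
    by (induction xs) auto
  then show ?thesis using tip c by (simp add: tip_def)
qed

theorem theorem4:
  fixes W :: nat
    and hashcode :: "'k \<Rightarrow> nat"
    and \<sigma> :: "('t, 'k, 'v) config"
  assumes "W \<ge> 1"
    and "reachable W hashcode \<sigma>"
    and "removes_completed \<sigma>"
  shows "\<exists>\<^sub>\<le>\<^sub>1 c. tip_of_length_1 (fst \<sigma>) c"
proof -
  obtain g own where inv: "config_inv g own \<sigma>" using config_inv_reachable[OF assms(2)] by blast
  let ?h = "heap (fst \<sigma>)"
  have st: "heap_inv g own ?h" using inv by (simp add: config_inv_def)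
  have "\<not> tip_of_length_1 (fst \<sigma>) c" for c
  proof
    assume "tip_of_length_1 (fst \<sigma>) c"
    then obtain p b xs i where tip: "tip ?h c" and p: "?h p = Some (CNode b xs)" "i \<in> set xs"
      "?h i = Some (INode (Some c))"
      by (auto simp: tip_of_length_1_def first_ancestor_cnode_def)
    obtain b' ys where c: "?h c = Some (CNode b' ys)" using tip by (auto simp: tip_def)
    \<comment> \<open>As an entry of the ancestor cnode, \<open>i\<close> is not a ghost root, so
      the invariant applies to it.\<close>
    have "g i \<noteq> i" using heap_inv_CNode(2)[OF st p(1,2)] p(3) by (auto simp: snode_def)
    moreover have "light_inode ?h i" using p(3) c tip_total_weight[OF st c tip] by (auto simp: light_inode_def)
    ultimately obtain t opn ctl where t: "snd \<sigma> t = Busy opn ctl" "will_compress ?h i ctl"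
      using inv by (auto simp: config_inv_def compression_due_def)
    have "ctl_inv g own ?h t opn ctl" using inv t(1) by (simp add: config_inv_def)
    then have "is_remove opn" by (rule will_compress_is_remove[OF _ t(2)])
    then show False using t(1) assms(3) by (auto simp: is_remove_def removes_completed_def)
  qed
  then show ?thesis by (simp add: Uniq_def)
qed

end
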